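(* Let $\mathcal H$ be a Hilbert space and $n\in\mathbb N$. An element $T\in \left(C(S^1)^{(n)}\otimes_{\rm min}\mathcal B(\mathcal H)\right)_+$ (that is, a positive $n\times n$ Toeplitz matrix with entries in $\mathcal B(\mathcal H)$) is pure if and only if there exist a complex number $\lambda\in S^1$, a rank-1 projection $Q\in\mathcal B(\mathcal H)$, and a scalar $\alpha\geq 0$ such that $$T=T_n(\lambda^{-1})\otimes(\alpha Q).$$
   Context: Hilbert spaces are complex, nonzero, and of arbitrary (finite or infinite) dimension; $\mathcal B(\mathcal H)$ is the algebra of bounded linear operators on $\mathcal H$; $S^1\subset\mathbb C$ is the unit circle; projections are self-adjoint idempotents. $C(S^1)^{(n)}$ is the operator system of all $n\times n$ complex Toeplitz matrices $[\tau_{k-j}]_{k,j=1}^n$, a subsystem of $\mathcal M_n(\mathbb C)$ with the identity matrix as order unit. The canonical basis is $\{r_\ell\}_{\ell=-n+1}^{n-1}$, where $r_\ell$ has $(k,j)$-entry $1$ if $k-j=\ell$ and $0$ otherwise. Elements $\sum_{\ell=-n+1}^{n-1} r_\ell\otimes\tau_\ell$ of $C(S^1)^{(n)}\otimes_{\rm min}\mathcal B(\mathcal H)$ ($\tau_\ell\in\mathcal B(\mathcal H)$) are identified with the block Toeplitz matrices $[\tau_{k-j}]_{k,j=1}^n$, and such an element is positive iff it is a positive operator on $\bigoplus_1^n\mathcal H$ (here $\otimes_{\rm min}$ is the spatial operator system tensor product). For $z\in S^1$, $T_n(z)=[z^{k-j}]_{k,j=1}^n\in C(S^1)^{(n)}$.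 An element $\phi$ of a convex cone $\mathcal C$ is pure if the equation $\vartheta+\omega=\phi$, with $\vartheta,\omega\in\mathcal C$, holds only if there is a scalar $s\in[0,1]$ with $\vartheta=s\phi$ and $\omega=(1-s)\phi$. Here the cone is $\left(C(S^1)^{(n)}\otimes_{\rm min}\mathcal B(\mathcal H)\right)_+$. *)

theory Defs
  imports
    "HOL-Analysis.Bounded_Linear_Function"
    "HOL-Library.Nonpos_Ints"
    "Jordan_Normal_Form.Matrix"
begin

unbundle no vec_syntax

text \<open>The real Banach space structure underlying a complex Hilbert space is taken from
  class \<^class>\<open>banach\<close>. The inner product is linear in its first argument. Positivity and
  definiteness of the inner product are contained in the last axiom.\<close>

class chilbert_space = banach +
  fixes scaleC :: "complex \<Rightarrow> 'a \<Rightarrow> 'a" (infixr "*\<^sub>C" 75)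
    and cinner :: "'a \<Rightarrow> 'a \<Rightarrow> complex"
  assumes scaleC_add_right: "c *\<^sub>C (x + y) = c *\<^sub>C x + c *\<^sub>C y"
    and scaleC_add_left: "(c + d) *\<^sub>C x = c *\<^sub>C x + d *\<^sub>C x"
    and scaleC_scaleC: "c *\<^sub>C (d *\<^sub>C x) = (c * d) *\<^sub>C x"
    and scaleR_scaleC: "r *\<^sub>R x = complex_of_real r *\<^sub>C x"
    and cinner_commute: "cinner x y = cnj (cinner y x)"
    and cinner_add_left: "cinner (x + y) z = cinner x z + cinner y z"
    and cinner_scaleC_left: "cinner (c *\<^sub>C x) y = c * cinner x y"
    and cinner_norm: "cinner x x = complex_of_real ((norm x)\<^sup>2)"

instantiation complex :: chilbert_space
begin

definition "scaleC_complex = ((*) :: complex \<Rightarrow> complex \<Rightarrow> complex)"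
definition "cinner_complex x y = (x::complex) * cnj y"

instance
  by standard
    (simp_all add: scaleC_complex_def cinner_complex_def algebra_simps scaleR_conv_of_real
      complex_norm_square flip: of_real_power)

end

lemma scaleC_one: "1 *\<^sub>C x = (x::'h::chilbert_space)"
  using scaleR_scaleC[of 1 x] by simp

global_interpretation complex_vector:
  vector_space "scaleC :: complex \<Rightarrow> 'h \<Rightarrow> 'h::chilbert_space"
  by standard (simp_all add: scaleC_add_right scaleC_add_left scaleC_scaleC scaleC_one)

lemma norm_scaleC: "norm (c *\<^sub>C x) = cmod c * norm (x::'h::chilbert_space)"
proof -
  have "complex_of_real ((norm (c *\<^sub>C x))\<^sup>2) = c * cnj (c * cinner x x)"
    by (metis cinner_norm cinner_scaleC_left cinner_commute)
  also have "\<dots> = (c * cnj c) * complex_of_real ((norm x)\<^sup>2)"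
    by (simp add: cinner_norm)
  also have "\<dots> = complex_of_real ((cmod c * norm x)\<^sup>2)"
    by (simp add: power_mult_distrib flip: complex_norm_square)
  finally have "(norm (c *\<^sub>C x))\<^sup>2 = (cmod c * norm x)\<^sup>2"
    using of_real_eq_iff by blast
  then show ?thesis by (simp add: power2_eq_iff_nonneg)
qed

text \<open>The type \<open>'h \<Rightarrow>\<^sub>L 'h\<close> consists of the bounded \<^emph>\<open>real\<close>-linear operators; the algebra
  of bounded operators on the complex Hilbert space is the following subset of it.\<close>

definition bounded_operators :: "('h::chilbert_space \<Rightarrow>\<^sub>L 'h) set" where
  "bounded_operators =
    {A. \<forall>c x. blinfun_apply A (c *\<^sub>C x) = c *\<^sub>C blinfun_apply A x}"

lift_definition scaleC_operator ::
    "complex \<Rightarrow> ('h::chilbert_space \<Rightarrow>\<^sub>L 'h) \<Rightarrow> ('h \<Rightarrow>\<^sub>L 'h)"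
  is "\<lambda>c A x. c *\<^sub>C A x"
proof -
  fix c :: complex and A :: "'h \<Rightarrow> 'h"
  assume A: "bounded_linear A"
  have "bounded_linear (\<lambda>x::'h. c *\<^sub>C x)"
    by (rule bounded_linear_intro[where K = "cmod c"])
      (simp_all add: scaleC_add_right scaleR_scaleC scaleC_scaleC norm_scaleC mult.commute)
  from bounded_linear_compose[OF this A] show "bounded_linear (\<lambda>x. c *\<^sub>C A x)" .
qed

definition projection :: "('h::chilbert_space \<Rightarrow>\<^sub>L 'h) \<Rightarrow> bool" where
  "projection Q \<longleftrightarrow> Q \<in> bounded_operators \<and> Q o\<^sub>L Q = Q \<and>
    (\<forall>x y. cinner (blinfun_apply Q x) y = cinner x (blinfun_apply Q y))"

text \<open>The library's dimension of an infinite-dimensional space is \<open>0\<close>, so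
  dimension \<open>1\<close> below does mean that the range is one-dimensional over the complex numbers.\<close>

definition rank_one :: "('h::chilbert_space \<Rightarrow>\<^sub>L 'h) \<Rightarrow> bool" where
  "rank_one Q \<longleftrightarrow> complex_vector.dim (range (blinfun_apply Q)) = 1"

text \<open>Matrix indices run from \<open>0\<close> to \<open>n - 1\<close>; the entry in row \<open>k\<close> and column \<open>j\<close> depends
  only on \<open>k - j\<close>, so this shift does not matter.\<close>

definition toeplitz_mat :: "nat \<Rightarrow> (int \<Rightarrow> 'a) \<Rightarrow> 'a mat" where
  "toeplitz_mat n \<tau> = mat n n (\<lambda>(k, j). \<tau> (int k - int j))"

definition T_mat :: "nat \<Rightarrow> complex \<Rightarrow> complex mat" where
  "T_mat n z = toeplitz_mat n (\<lambda>l. z powi l)"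

definition tensor_op ::
    "complex mat \<Rightarrow> ('h::chilbert_space \<Rightarrow>\<^sub>L 'h) \<Rightarrow> ('h \<Rightarrow>\<^sub>L 'h) mat" (infixr "\<otimes>\<^sub>o" 70) where
  "M \<otimes>\<^sub>o A = map_mat (\<lambda>c. scaleC_operator c A) M"

text \<open>The tensor product of the operator system of Toeplitz matrices with the bounded operators.
  Since the first factor is finite-dimensional with basis \<open>r\<^sub>l\<close>, the elements are the
  finite sums of the \<open>r\<^sub>l \<otimes> \<tau>\<^sub>l\<close> (see \<open>toeplitz_mat_entry_sum\<close> below), i.e. the block Toeplitz
  matrices.\<close>

definition toeplitz_tensor :: "nat \<Rightarrow> ('h::chilbert_space \<Rightarrow>\<^sub>L 'h) mat set" where
  "toeplitz_tensor n = {toeplitz_mat n \<tau> | \<tau>. \<forall>l. \<tau> l \<in> bounded_operators}"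

definition r_mat :: "nat \<Rightarrow> int \<Rightarrow> complex mat" where
  "r_mat n l = toeplitz_mat n (\<lambda>m. if m = l then 1 else 0)"

lemma toeplitz_mat_entry_sum:
  assumes "k < n" "j < n"
  shows "toeplitz_mat n \<tau> $$ (k, j) = (\<Sum>l = - int n + 1..int n - 1. (r_mat n l \<otimes>\<^sub>o \<tau> l) $$ (k, j))"
proof -
  have one: "scaleC_operator 1 A = A" and zero: "scaleC_operator 0 A = 0"
    for A :: "'b::chilbert_space \<Rightarrow>\<^sub>L 'b"
    by (transfer, simp add: scaleC_one fun_eq_iff)+
  have "(\<Sum>l = - int n + 1..int n - 1. (r_mat n l \<otimes>\<^sub>o \<tau> l) $$ (k, j))
      = (\<Sum>l = - int n + 1..int n - 1. if int k - int j = l then \<tau> l else 0)"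
    using assms
    by (intro sum.cong) (simp_all add: tensor_op_def r_mat_def toeplitz_mat_def one zero)
  also have "\<dots> = \<tau> (int k - int j)"
    using assms by (subst sum.delta') auto
  finally show ?thesis using assms by (simp add: toeplitz_mat_def)
qed

text \<open>The \<open>n\<close>-fold direct sum of the Hilbert space is \<open>carrier_vec n\<close>.\<close>

definition block_apply :: "('h::chilbert_space \<Rightarrow>\<^sub>L 'h) mat \<Rightarrow> 'h vec \<Rightarrow> 'h vec" where
  "block_apply T x =
    vec (dim_row T) (\<lambda>k. \<Sum>j<dim_col T. blinfun_apply (T $$ (k, j)) (x $ j))"

definition dsum_inner :: "'h::chilbert_space vec \<Rightarrow> 'h vec \<Rightarrow> complex" where
  "dsum_inner x y = (\<Sum>k<dim_vec x. cinner (x $ k) (y $ k))"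

definition positive_block :: "nat \<Rightarrow> ('h::chilbert_space \<Rightarrow>\<^sub>L 'h) mat \<Rightarrow> bool" where
  "positive_block n T \<longleftrightarrow>
    (\<forall>x \<in> carrier_vec n. dsum_inner (block_apply T x) x \<in> \<real>\<^sub>\<ge>\<^sub>0)"

definition toeplitz_cone :: "nat \<Rightarrow> ('h::chilbert_space \<Rightarrow>\<^sub>L 'h) mat set" where
  "toeplitz_cone n = {T \<in> toeplitz_tensor n. positive_block n T}"

definition pure_element :: "'a::real_vector mat set \<Rightarrow> 'a mat \<Rightarrow> bool" where
  "pure_element C \<phi> \<longleftrightarrow> \<phi> \<in> C \<and>
    (\<forall>\<theta> \<in> C. \<forall>\<omega> \<in> C. \<theta> + \<omega> = \<phi> \<longrightarrow>
      (\<exists>s \<in> {0..1}. \<theta> = map_mat (scaleR s) \<phi> \<and> \<omega> = map_mat (scaleR (1 - s)) \<phi>))"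

end

theory Submission
  imports Defs "HOL-Library.Function_Algebras"
begin

text \<open>A positive block Toeplitz matrix \<open>[\<tau>\<^bsub>k-j\<^esub>]\<close> of size \<open>n\<close> extends to a positive block Toeplitz
  matrix of size \<open>n + 1\<close>: in the seminorm given by the matrix, project the first coordinate space to
  the span of the \<open>n - 1\<close> middle ones, and let the new corner entry pair this projection
  with the last coordinate space. For \<open>\<bar>a\<bar> = 1\<close> the extension shows that multiplying the symbol by
  \<open>\<bar>1 + a z\<bar>\<^sup>2 / 4\<close> gives a positive matrix of size \<open>n\<close>, and the ones for \<open>a\<close> and \<open>- a\<close> add up
  to the given matrix. If that matrix is pure, the choices \<open>a = 1\<close> and \<open>a = \<i>\<close> yield
  \<open>\<tau>\<^bsub>l+1\<^esub> = \<mu> \<tau>\<^sub>l\<close> and \<open>\<tau>\<^bsub>l-1\<^esub> = cnj \<mu> \<tau>\<^sub>l\<close>, so that \<open>\<tau>\<^sub>l = \<mu>\<^sup>l \<tau>\<^sub>0\<close> with \<open>\<bar>\<mu>\<bar> = 1\<close>.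
  Finally \<open>\<tau>\<^sub>0\<close> dominates the rank-one operator \<open>x \<mapsto> \<langle>x, g\<rangle> g / \<langle>g, y\<rangle>\<close> with
  \<open>g = \<tau>\<^sub>0 y\<close>, and purity makes it a multiple of this operator. Conversely, a Toeplitz matrix of the
  stated form is a rank-one positive operator, and whatever it dominates is a multiple of it.\<close>

text \<open>Vectors of a direct sum are handled below as functions of the index. Pointwise
  operations turn these into a real vector space, to which \<open>subspace\<close> and
  \<open>bilinear\<close> apply.\<close>

instantiation "fun" :: (type, real_vector) real_vector
begin

definition "scaleR_fun r f = (\<lambda>x. r *\<^sub>R f x)"

instance
  by standard (simp_all add: scaleR_fun_def fun_eq_iff algebra_simps)

end

lemma scaleR_fun_apply [simp]: "(r *\<^sub>R f) x = r *\<^sub>R f x"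
  by (simp add: scaleR_fun_def)

section \<open>Approximate projections for a positive semidefinite form\<close>

text \<open>Hermitian forms enter through their real parts. Positivity is kept apart, in
  \<open>psd_on\<close>, because the enlarged Toeplitz form is at first known to be positive only on
  two subspaces.\<close>

locale symmetric_form =
  fixes b :: "'v::real_vector \<Rightarrow> 'v \<Rightarrow> real"
  assumes bil: "bilinear b"
    and sym: "b x y = b y x"
begin

lemmas expand = bilinear_ladd[OF bil] bilinear_radd[OF bil] bilinear_lsub[OF bil]
  bilinear_rsub[OF bil] bilinear_lmul[OF bil] bilinear_rmul[OF bil]

definition psd_on :: "'v set \<Rightarrow> bool" where
  "psd_on X \<longleftrightarrow> subspace X \<and> (\<forall>x\<in>X. b x x \<ge> 0)"

definition seminorm :: "'v \<Rightarrow> real" where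
  "seminorm x = sqrt (b x x)"

lemma psd_onD: "psd_on X \<Longrightarrow> x \<in> X \<Longrightarrow> b x x \<ge> 0"
  by (simp add: psd_on_def)

lemma psd_on_subspace: "psd_on X \<Longrightarrow> subspace X"
  by (simp add: psd_on_def)

lemma b_diff_scale: "b (x - t *\<^sub>R y) (x - t *\<^sub>R y) = b x x - 2 * t * b x y + t\<^sup>2 * b y y"
  by (simp add: expand sym[of y x] power2_eq_square algebra_simps)

text \<open>Discriminant criterion with a free constant term: \<open>\<epsilon> = b x x\<close>
  yields Cauchy-Schwarz, and \<open>\<epsilon> = 1 / (m + 1)\<close> the near orthogonality of an
  almost minimal residual.\<close>

lemma square_le_of_quadratic:
  fixes \<beta> :: real
  assumes le: "\<And>t. 0 \<le> \<epsilon> - 2 * t * \<beta> + t\<^sup>2 * \<gamma>" and "\<gamma> \<ge> 0"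
  shows "\<beta>\<^sup>2 \<le> \<epsilon> * \<gamma>"
proof (cases "\<gamma> = 0")
  case True
  show ?thesis
  proof (cases "\<beta> = 0")
    case False
    \<comment> \<open>For \<open>\<gamma> = 0\<close> the expression is affine in \<open>t\<close>,
      and this \<open>t\<close> would give it the value -1.\<close>
    have "0 \<le> \<epsilon> - 2 * ((\<epsilon> + 1) / (2 * \<beta>)) * \<beta>"
      using le[of "(\<epsilon> + 1) / (2 * \<beta>)"] True by simp
    with False show ?thesis by simp
  qed (simp add: True)
next
  case False
  with \<open>\<gamma> \<ge> 0\<close> have "\<gamma> > 0" by simp
  \<comment> \<open>\<open>\<beta> / \<gamma>\<close> is the minimiser of the quadratic.\<close>
  have "0 \<le> \<epsilon> - 2 * (\<beta> / \<gamma>) * \<beta> + (\<beta> / \<gamma>)\<^sup>2 * \<gamma>"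
    by (rule le)
  also have "\<dots> = \<epsilon> - \<beta>\<^sup>2 / \<gamma>"
    using \<open>\<gamma> > 0\<close> by (simp add: power2_eq_square field_simps)
  finally show ?thesis
    using \<open>\<gamma> > 0\<close> by (simp add: field_simps)
qed

lemma cauchy_schwarz:
  assumes X: "psd_on X" and "x \<in> X" "y \<in> X"
  shows "\<bar>b x y\<bar> \<le> seminorm x * seminorm y"
proof -
  have "(b x y)\<^sup>2 \<le> b x x * b y y"
  proof (rule square_le_of_quadratic)
    fix t
    have "x - t *\<^sub>R y \<in> X"
      using psd_on_subspace[OF X] assms by (intro subspace_diff subspace_scale)
    from psd_onD[OF X this] show "0 \<le> b x x - 2 * t * b x y + t\<^sup>2 * b y y"
      by (simp add: b_diff_scale)
  qed (use psd_onD[OF X] assms in auto)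
  then have "sqrt ((b x y)\<^sup>2) \<le> sqrt (b x x * b y y)"
    by (rule real_sqrt_le_mono)
  then show ?thesis
    by (simp add: seminorm_def real_sqrt_mult)
qed

lemma seminorm_nonneg: "psd_on X \<Longrightarrow> x \<in> X \<Longrightarrow> seminorm x \<ge> 0"
  by (simp add: seminorm_def psd_onD)

lemma seminorm_square: "psd_on X \<Longrightarrow> x \<in> X \<Longrightarrow> b x x = seminorm x * seminorm x"
  by (simp add: seminorm_def psd_onD)

text \<open>The sequence stands for the projection of \<open>u\<close> to the completion of
  \<open>D\<close> modulo null vectors. The error is measured relative to \<open>seminorm e\<close>,
  so that the test vector may vary with \<open>m\<close>.\<close>

definition approx_proj :: "'v set \<Rightarrow> 'v \<Rightarrow> (nat \<Rightarrow> 'v) \<Rightarrow> bool" where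
  "approx_proj D u d \<longleftrightarrow> (\<forall>m. d m \<in> D) \<and>
    (\<exists>\<epsilon>. \<epsilon> \<longlonglongrightarrow> 0 \<and> (\<forall>m. \<forall>e\<in>D. \<bar>b (u - d m) e\<bar> \<le> \<epsilon> m * seminorm e))"

text \<open>The sequence minimises \<open>b (u - d) (u - d)\<close> over \<open>D\<close>; an almost minimal residual is almost
  orthogonal to \<open>D\<close>. The form may be degenerate and \<open>D\<close> need not be complete, so an exact projection
  need not exist.\<close>

lemma approx_proj_exists:
  assumes X: "psd_on X" and D: "subspace D" "D \<subseteq> X" and u: "u \<in> X"
  shows "\<exists>d. approx_proj D u d"
proof -
  define q where "q d = b (u - d) (u - d)" for d
  define I where "I = Inf (q ` D)"
  have diff: "u - d \<in> X" if "d \<in> D" for d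
    using that D u psd_on_subspace[OF X] by (intro subspace_diff) auto
  have ne: "q ` D \<noteq> {}"
    using subspace_0[OF D(1)] by blast
  have bdd: "bdd_below (q ` D)"
    using psd_onD[OF X diff] by (intro bdd_belowI[of _ 0]) (auto simp: q_def)
  have I_le: "I \<le> q d" if "d \<in> D" for d
    unfolding I_def using that bdd by (intro cInf_lower) auto
  have "\<exists>d\<in>D. q d < I + 1 / real (Suc m)" for m
    using cInf_lessD[OF ne, of "I + 1 / real (Suc m)"] by (auto simp: I_def)
  then obtain d where d: "\<And>m. d m \<in> D" "\<And>m. q (d m) < I + 1 / real (Suc m)"
    by metis
  have "\<bar>b (u - d m) e\<bar> \<le> sqrt (1 / real (Suc m)) * seminorm e" if e: "e \<in> D" for m e
  proof -
    have "(b (u - d m) e)\<^sup>2 \<le> (1 / real (Suc m)) * b e e"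
    proof (rule square_le_of_quadratic)
      fix t
      have "d m + t *\<^sub>R e \<in> D"
        using D(1) d(1) e by (intro subspace_add subspace_scale)
      from I_le[OF this] have "I \<le> b (u - d m - t *\<^sub>R e) (u - d m - t *\<^sub>R e)"
        by (simp add: q_def diff_diff_eq)
      then show "0 \<le> 1 / real (Suc m) - 2 * t * b (u - d m) e + t\<^sup>2 * b e e"
        using d(2)[of m] unfolding b_diff_scale q_def by linarith
    qed (use psd_onD[OF X] e D in auto)
    then have "sqrt ((b (u - d m) e)\<^sup>2) \<le> sqrt (1 / real (Suc m) * b e e)"
      by (rule real_sqrt_le_mono)
    then show ?thesis
      by (simp add: seminorm_def real_sqrt_mult real_sqrt_divide)
  qed
  moreover have "(\<lambda>m. sqrt (1 / real (Suc m))) \<longlonglongrightarrow> 0"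
    using tendsto_real_sqrt[OF LIMSEQ_inverse_real_of_nat] by (simp add: inverse_eq_divide)
  ultimately show ?thesis
    unfolding approx_proj_def using d(1) by blast
qed

lemma approx_proj_add:
  assumes D: "subspace D" and "approx_proj D u d" "approx_proj D v d'"
  shows "approx_proj D (u + v) (\<lambda>m. d m + d' m)"
proof -
  obtain \<epsilon> \<epsilon>' where "\<epsilon> \<longlonglongrightarrow> 0" "\<epsilon>' \<longlonglongrightarrow> 0"
    and le: "\<And>m e. e \<in> D \<Longrightarrow> \<bar>b (u - d m) e\<bar> \<le> \<epsilon> m * seminorm e"
      "\<And>m e. e \<in> D \<Longrightarrow> \<bar>b (v - d' m) e\<bar> \<le> \<epsilon>' m * seminorm e"
    using assms unfolding approx_proj_def by metis
  have "\<bar>b (u + v - (d m + d' m)) e\<bar> \<le> (\<epsilon> m + \<epsilon>' m) * seminorm e" if "e \<in> D" for m e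
    using le(1)[OF that, of m] le(2)[OF that, of m] by (simp add: expand algebra_simps)
  moreover have "(\<lambda>m. \<epsilon> m + \<epsilon>' m) \<longlonglongrightarrow> 0"
    using tendsto_add[OF \<open>\<epsilon> \<longlonglongrightarrow> 0\<close> \<open>\<epsilon>' \<longlonglongrightarrow> 0\<close>] by simp
  ultimately show ?thesis
    unfolding approx_proj_def using assms subspace_add[OF D]
    by (auto simp: approx_proj_def intro!: exI[of _ "\<lambda>m. \<epsilon> m + \<epsilon>' m"])
qed

text \<open>The difference \<open>e = d m - d' l\<close> lies in \<open>D\<close>, and its square is
  the difference of two residuals paired with \<open>e\<close>; one factor \<open>seminorm e\<close>
  cancels. With \<open>d = d'\<close> this is a Cauchy property, with \<open>m = l\<close>
  uniqueness of the projection.\<close>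

lemma approx_proj_dist:
  assumes X: "psd_on X" and D: "subspace D" "D \<subseteq> X"
    and d: "approx_proj D u d" and d': "approx_proj D u d'"
  shows "\<exists>\<delta>. \<delta> \<longlonglongrightarrow> 0 \<and> (\<forall>m l. seminorm (d m - d' l) \<le> \<delta> m + \<delta> l)"
proof -
  obtain \<epsilon> \<epsilon>' where lim: "\<epsilon> \<longlonglongrightarrow> 0" "\<epsilon>' \<longlonglongrightarrow> 0"
    and le: "\<And>m e. e \<in> D \<Longrightarrow> \<bar>b (u - d m) e\<bar> \<le> \<epsilon> m * seminorm e"
      "\<And>m e. e \<in> D \<Longrightarrow> \<bar>b (u - d' m) e\<bar> \<le> \<epsilon>' m * seminorm e"
    using d d' unfolding approx_proj_def by metis
  have "seminorm (d m - d' l) \<le> (\<bar>\<epsilon> m\<bar> + \<bar>\<epsilon>' m\<bar>) + (\<bar>\<epsilon> l\<bar> + \<bar>\<epsilon>' l\<bar>)" for m l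
  proof -
    let ?e = "d m - d' l"
    have e: "?e \<in> D"
      using d d' subspace_diff[OF D(1)] by (auto simp: approx_proj_def)
    have nn: "seminorm ?e \<ge> 0"
      using seminorm_nonneg[OF X] e D by auto
    have "seminorm ?e * seminorm ?e = b (u - d' l) ?e - b (u - d m) ?e"
      using seminorm_square[OF X, of ?e] e D by (auto simp: expand)
    also have "\<dots> \<le> (\<epsilon>' l + \<epsilon> m) * seminorm ?e"
      using le(1)[OF e, of m] le(2)[OF e, of l] by (simp add: algebra_simps)
    finally have "seminorm ?e \<le> \<epsilon>' l + \<epsilon> m \<or> seminorm ?e = 0"
      using nn by (metis linorder_not_less mult_right_le_imp_le order_le_less)
    then show ?thesis
      by linarith
  qed
  moreover have "(\<lambda>m. \<bar>\<epsilon> m\<bar> + \<bar>\<epsilon>' m\<bar>) \<longlonglongrightarrow> 0"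
    using tendsto_add[OF tendsto_rabs_zero[OF lim(1)] tendsto_rabs_zero[OF lim(2)]] by simp
  ultimately show ?thesis by blast
qed

text \<open>Orthogonality in the limit, also against moving test vectors such as the approximate
  projections themselves.\<close>

lemma approx_proj_residual:
  assumes X: "psd_on X" and D: "D \<subseteq> X" and u: "u \<in> X" and d: "approx_proj D u d"
    and f: "\<And>m. f m \<in> D" "\<And>m. seminorm (f m) \<le> K"
  shows "(\<lambda>m. b (u - d m) (f m)) \<longlonglongrightarrow> 0"
proof -
  obtain \<epsilon> where lim: "\<epsilon> \<longlonglongrightarrow> 0"
    and le: "\<And>m e. e \<in> D \<Longrightarrow> \<bar>b (u - d m) e\<bar> \<le> \<epsilon> m * seminorm e"
    using d unfolding approx_proj_def by metis
  have "norm (b (u - d m) (f m)) \<le> \<bar>\<epsilon> m\<bar> * \<bar>K\<bar>" for m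
  proof -
    have "\<bar>b (u - d m) (f m)\<bar> \<le> \<epsilon> m * seminorm (f m)"
      using le f by blast
    also have "\<dots> \<le> \<bar>\<epsilon> m\<bar> * \<bar>K\<bar>"
      using seminorm_nonneg[OF X, of "f m"] f[of m] D by (intro mult_mono) auto
    finally show ?thesis by simp
  qed
  moreover have "(\<lambda>m. \<bar>\<epsilon> m\<bar> * \<bar>K\<bar>) \<longlonglongrightarrow> 0"
    using tendsto_mult_left_zero[OF tendsto_rabs_zero[OF lim]] .
  ultimately show ?thesis
    using Lim_null_comparison by (metis (mono_tags, lifting) always_eventually)
qed

text \<open>A projection is a contraction; here up to the error found by testing the residual
  against \<open>d m\<close> itself.\<close>

lemma approx_proj_bounded:
  assumes X: "psd_on X" and D: "D \<subseteq> X" and u: "u \<in> X" and d: "approx_proj D u d"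
  shows "\<exists>\<epsilon>. \<epsilon> \<longlonglongrightarrow> 0 \<and> (\<forall>m. seminorm (d m) \<le> seminorm u + \<epsilon> m)"
proof -
  obtain \<epsilon> where lim: "\<epsilon> \<longlonglongrightarrow> 0"
    and le: "\<And>m e. e \<in> D \<Longrightarrow> \<bar>b (u - d m) e\<bar> \<le> \<epsilon> m * seminorm e"
    and dD: "\<And>m. d m \<in> D"
    using d unfolding approx_proj_def by metis
  have "seminorm (d m) \<le> seminorm u + \<bar>\<epsilon> m\<bar>" for m
  proof -
    have dX: "d m \<in> X" using dD D by auto
    have "seminorm (d m) * seminorm (d m) = b u (d m) - b (u - d m) (d m)"
      using seminorm_square[OF X dX] by (simp add: expand)
    also have "\<dots> \<le> (seminorm u + \<epsilon> m) * seminorm (d m)"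
      using le[OF dD, of m m] cauchy_schwarz[OF X u dX] by (simp add: algebra_simps)
    finally have "seminorm (d m) \<le> seminorm u + \<epsilon> m \<or> seminorm (d m) = 0"
      using seminorm_nonneg[OF X dX] by (metis linorder_not_less mult_right_le_imp_le order_le_less)
    then show ?thesis
      using seminorm_nonneg[OF X u] by linarith
  qed
  with tendsto_rabs_zero[OF lim] show ?thesis by blast
qed

lemma approx_proj_bounded':
  assumes X: "psd_on X" and D: "D \<subseteq> X" and u: "u \<in> X" and d: "approx_proj D u d"
  shows "\<exists>K. \<forall>m. seminorm (d m) \<le> K"
proof -
  obtain \<epsilon> where \<epsilon>: "\<epsilon> \<longlonglongrightarrow> 0" "\<And>m. seminorm (d m) \<le> seminorm u + \<epsilon> m"
    using approx_proj_bounded[OF assms] by blast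
  obtain M where "\<And>m. norm (\<epsilon> m) \<le> M"
    using convergent_imp_Bseq[of \<epsilon>] \<epsilon>(1) by (auto simp: convergent_def Bseq_def)
  then have "seminorm (d m) \<le> seminorm u + M" for m
    using \<epsilon>(2)[of m] by (smt (verit) real_norm_def)
  then show ?thesis by blast
qed

text \<open>With \<open>c\<close> in the role of \<open>b u v\<close>: the form stays positive on \<open>u + v\<close> when the unknown entry
  pairing \<open>u\<close> and \<open>v\<close> is taken to be the pairing of the projection of \<open>u\<close> with \<open>v\<close>.\<close>

lemma completion_nonneg:
  assumes X: "psd_on X" "psd_on Y" and D: "subspace D" "D \<subseteq> X" "D \<subseteq> Y"
    and u: "u \<in> X" and v: "v \<in> Y" and d: "approx_proj D u d"
    and c: "(\<lambda>m. b (d m) v) \<longlonglongrightarrow> c"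
  shows "b u u + b v v + 2 * c \<ge> 0"
proof -
  have dD: "d m \<in> D" for m
    using d by (simp add: approx_proj_def)
  obtain K where K: "\<And>m. seminorm (d m) \<le> K"
    using approx_proj_bounded'[OF X(1) D(2) u d] by blast
  have "0 \<le> b u u + b v v + 2 * b (d m) v - 2 * b (u - d m) (d m)" for m
  proof -
    \<comment> \<open>The vector \<open>u + v\<close> is split into the residual
      \<open>u - d m\<close> in \<open>X\<close> and \<open>d m + v\<close> in \<open>Y\<close>,
      where the form is nonnegative. The cross term of residual and projection vanishes in the
      limit.\<close>
    have "u - d m \<in> X" "d m + v \<in> Y"
      using dD D u v X by (auto intro!: subspace_diff subspace_add psd_on_subspace)
    then have "0 \<le> b (u - d m) (u - d m) + b (d m + v) (d m + v)"
      by (intro add_nonneg_nonneg psd_onD[OF X(1)] psd_onD[OF X(2)])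
    also have "\<dots> = b u u + b v v + 2 * b (d m) v - 2 * b (u - d m) (d m)"
      by (simp add: expand sym[of v "d m"] sym[of "d m" u])
    finally show ?thesis .
  qed
  moreover have "(\<lambda>m. b u u + b v v + 2 * b (d m) v - 2 * b (u - d m) (d m))
      \<longlonglongrightarrow> b u u + b v v + 2 * c - 2 * 0"
    by (intro tendsto_intros c approx_proj_residual[OF X(1) D(2) u d dD K])
  ultimately have "0 \<le> b u u + b v v + 2 * c - 2 * 0"
    by (intro LIMSEQ_le_const) auto
  then show ?thesis by simp
qed

end

section \<open>Inner products and operators\<close>

lemma cinner_add_right: "cinner x (y + z) = cinner x y + cinner x (z::'h::chilbert_space)"
  by (metis cinner_add_left cinner_commute complex_cnj_add)

lemma cinner_scaleC_right: "cinner x (c *\<^sub>C y) = cnj c * cinner x (y::'h::chilbert_space)"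
  by (metis cinner_commute cinner_scaleC_left complex_cnj_mult)

lemma cinner_zero_left [simp]: "cinner 0 (y::'h::chilbert_space) = 0"
  using cinner_scaleC_left[of 0 0 y] by simp

lemma cinner_zero_right [simp]: "cinner (y::'h::chilbert_space) 0 = 0"
  using cinner_scaleC_right[of y 0 0] by simp

lemma cinner_minus_left: "cinner (- x) (y::'h::chilbert_space) = - cinner x y"
  using cinner_add_left[of x "- x" y] by (simp add: add_eq_0_iff2 add_eq_0_iff)

lemma cinner_minus_right: "cinner y (- x) = - cinner y (x::'h::chilbert_space)"
  using cinner_add_right[of y x "- x"] by (simp add: add_eq_0_iff)

lemma cinner_diff_left: "cinner (x - z) (y::'h::chilbert_space) = cinner x y - cinner z y"
  using cinner_add_left[of x "- z" y] by (simp add: cinner_minus_left)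

lemma cinner_diff_right: "cinner y (x - z) = cinner y x - cinner y (z::'h::chilbert_space)"
  using cinner_add_right[of y x "- z"] by (simp add: cinner_minus_right)

lemma cinner_sum_left: "cinner (sum f A) (y::'h::chilbert_space) = (\<Sum>a\<in>A. cinner (f a) y)"
  by (induction A rule: infinite_finite_induct) (simp_all add: cinner_add_left)

lemma cinner_scaleR_left: "cinner (r *\<^sub>R x) (y::'h::chilbert_space) = of_real r * cinner x y"
  by (simp add: scaleR_scaleC cinner_scaleC_left)

lemma cinner_scaleR_right: "cinner x (r *\<^sub>R y) = of_real r * cinner x (y::'h::chilbert_space)"
  by (simp add: scaleR_scaleC cinner_scaleC_right)

lemmas cinner_simps = cinner_add_left cinner_add_right cinner_diff_left cinner_diff_right
  cinner_minus_left cinner_minus_right cinner_scaleC_left cinner_scaleC_right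
  cinner_scaleR_left cinner_scaleR_right

lemma cinner_self_eq_0 [simp]: "cinner x x = 0 \<longleftrightarrow> x = (0::'h::chilbert_space)"
  by (simp add: cinner_norm)

lemma cinner_eqI:
  fixes x y :: "'h::chilbert_space"
  assumes "\<And>z. cinner x z = cinner y z"
  shows "x = y"
proof -
  have "cinner (x - y) (x - y) = 0"
    by (simp add: cinner_diff_left assms)
  then show ?thesis by simp
qed

interpretation cinner_form: symmetric_form "\<lambda>x y. Re (cinner x (y::'h::chilbert_space))"
proof
  show "bilinear (\<lambda>x y. Re (cinner x (y::'h)))"
    unfolding bilinear_def by (auto intro!: linearI simp: cinner_simps)
  show "Re (cinner x y) = Re (cinner y x)" for x y :: 'h
    by (metis cinner_commute complex_cnj cnj.sel(1))
qed

lemma Re_cinner_le: "\<bar>Re (cinner x y)\<bar> \<le> norm x * norm (y::'h::chilbert_space)"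
  using cinner_form.cauchy_schwarz[of UNIV x y]
  by (simp add: cinner_form.psd_on_def cinner_form.seminorm_def cinner_norm)

lemma Im_cinner: "Im (cinner x y) = Re (cinner x (\<i> *\<^sub>C (y::'h::chilbert_space)))"
  by (simp add: cinner_scaleC_right)

text \<open>Real and imaginary part are bounded separately, whence the factor 2; the estimate serves
  only to show that operators are bounded.\<close>

lemma norm_cinner_le: "cmod (cinner x y) \<le> 2 * norm x * norm (y::'h::chilbert_space)"
  using Re_cinner_le[of x y] Re_cinner_le[of x "\<i> *\<^sub>C y"] cmod_le[of "cinner x y"]
  by (simp add: Im_cinner norm_scaleC)

lemma tendsto_Re_cinner:
  fixes w :: "'h::chilbert_space"
  assumes "f \<longlonglongrightarrow> w"
  shows "(\<lambda>m. Re (cinner (f m) y)) \<longlonglongrightarrow> Re (cinner w y)"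
proof -
  have "bounded_linear (\<lambda>x. Re (cinner x y))"
    by (rule bounded_linear_intro[of _ "norm y"])
      (use Re_cinner_le[of _ y] in \<open>simp_all add: cinner_simps\<close>)
  from bounded_linear.tendsto[OF this assms] show ?thesis .
qed

lemma bounded_operatorsD:
  "A \<in> bounded_operators \<Longrightarrow> blinfun_apply A (c *\<^sub>C x) = c *\<^sub>C blinfun_apply A x"
  by (simp add: bounded_operators_def)

lemma bounded_operators_zero: "0 \<in> bounded_operators"
  by (simp add: bounded_operators_def)

lemma bounded_operators_add:
  "A \<in> bounded_operators \<Longrightarrow> B \<in> bounded_operators \<Longrightarrow> A + B \<in> bounded_operators"
  by (simp add: bounded_operators_def blinfun.add_left scaleC_add_right)

lemma bounded_operators_scaleC:
  "A \<in> bounded_operators \<Longrightarrow> scaleC_operator c A \<in> bounded_operators"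
  by (simp add: bounded_operators_def scaleC_operator.rep_eq scaleC_scaleC mult.commute)

lemma bounded_operators_scaleR:
  "A \<in> bounded_operators \<Longrightarrow> r *\<^sub>R A \<in> bounded_operators"
  by (simp add: bounded_operators_def blinfun.scaleR_left scaleR_scaleC scaleC_scaleC mult.commute)

lemma bounded_operatorsI:
  fixes f :: "'h::chilbert_space \<Rightarrow> 'h"
  assumes "\<And>x y. f (x + y) = f x + f y" "\<And>c x. f (c *\<^sub>C x) = c *\<^sub>C f x"
    and "\<And>x. norm (f x) \<le> norm x * K"
  shows "\<exists>A\<in>bounded_operators. blinfun_apply A = f"
proof -
  have "bounded_linear f"
    using assms by (intro bounded_linear_intro[of f K]) (simp_all add: scaleR_scaleC)
  then show ?thesis
    using assms(2) by (intro bexI[of _ "Blinfun f"])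
      (simp_all add: bounded_operators_def bounded_linear_Blinfun_apply)
qed

section \<open>The sesquilinear form of a block Toeplitz matrix\<close>

text \<open>Arguments are families over all naturals, of which the entries below \<open>n\<close>
  count. Forms of size \<open>n\<close> and \<open>n + 1\<close> can thus be evaluated at the same
  vector.\<close>

definition toeplitz_form ::
    "nat \<Rightarrow> (int \<Rightarrow> 'h::chilbert_space \<Rightarrow>\<^sub>L 'h) \<Rightarrow> (nat \<Rightarrow> 'h) \<Rightarrow> (nat \<Rightarrow> 'h) \<Rightarrow> complex" where
  "toeplitz_form n \<tau> x y =
    (\<Sum>k<n. \<Sum>j<n. cinner (blinfun_apply (\<tau> (int k - int j)) (x j)) (y k))"

definition single :: "nat \<Rightarrow> 'h::zero \<Rightarrow> nat \<Rightarrow> 'h" where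
  "single i x = (\<lambda>j. if j = i then x else 0)"

lemma single_add: "single i (x + y) = single i x + single i (y::'h::chilbert_space)"
  by (auto simp: single_def fun_eq_iff)

lemma single_scaleC: "single i (c *\<^sub>C x) = (\<lambda>j. c *\<^sub>C single i (x::'h::chilbert_space) j)"
  by (auto simp: single_def fun_eq_iff)

lemma toeplitz_form_bilinear:
  "bilinear (\<lambda>x y. Re (toeplitz_form n \<tau> x y))"
  unfolding bilinear_def
  by (auto intro!: linearI simp: toeplitz_form_def cinner_simps blinfun.add_right
      blinfun.scaleR_right sum.distrib sum_distrib_left)

lemma toeplitz_form_add_left:
  "toeplitz_form n \<tau> (x + x') y = toeplitz_form n \<tau> x y + toeplitz_form n \<tau> x' y"
  by (simp add: toeplitz_form_def cinner_simps blinfun.add_right sum.distrib)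

lemma toeplitz_form_add_right:
  "toeplitz_form n \<tau> x (y + y') = toeplitz_form n \<tau> x y + toeplitz_form n \<tau> x y'"
  by (simp add: toeplitz_form_def cinner_simps sum.distrib)

lemma toeplitz_form_scaleC_left:
  assumes "\<And>l. \<tau> l \<in> bounded_operators"
  shows "toeplitz_form n \<tau> (\<lambda>j. c *\<^sub>C x j) y = c * toeplitz_form n \<tau> x y"
  by (simp add: toeplitz_form_def cinner_simps bounded_operatorsD[OF assms] sum_distrib_left)

lemma toeplitz_form_scaleC_right:
  "toeplitz_form n \<tau> x (\<lambda>j. c *\<^sub>C y j) = cnj c * toeplitz_form n \<tau> x y"
  by (simp add: toeplitz_form_def cinner_simps sum_distrib_left)

lemma toeplitz_form_single_right:
  assumes "i < n"
  shows "toeplitz_form n \<tau> x (single i y) =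
    cinner (\<Sum>j<n. blinfun_apply (\<tau> (int i - int j)) (x j)) y"
proof -
  have "toeplitz_form n \<tau> x (single i y) =
      (\<Sum>k<n. if k = i then \<Sum>j<n. cinner (blinfun_apply (\<tau> (int k - int j)) (x j)) y else 0)"
    unfolding toeplitz_form_def by (intro sum.cong) (auto simp: single_def)
  then show ?thesis
    using assms by (simp add: cinner_sum_left)
qed

lemma toeplitz_form_single:
  assumes "i < n" "k < n"
  shows "toeplitz_form n \<tau> (single k x) (single i y) =
    cinner (blinfun_apply (\<tau> (int i - int k)) x) y"
proof -
  have "(\<Sum>j<n. blinfun_apply (\<tau> (int i - int j)) (single k x j)) =
      (\<Sum>j<n. if j = k then blinfun_apply (\<tau> (int i - int j)) x else 0)"
    by (intro sum.cong) (auto simp: single_def)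
  then show ?thesis
    using assms by (simp add: toeplitz_form_single_right)
qed

lemma toeplitz_form_cong:
  assumes "\<And>l. \<bar>l\<bar> < int n \<Longrightarrow> \<tau> l = \<tau>' l" "\<And>j. j < n \<Longrightarrow> x j = x' j" "\<And>j. j < n \<Longrightarrow> y j = y' j"
  shows "toeplitz_form n \<tau> x y = toeplitz_form n \<tau>' x' y'"
  unfolding toeplitz_form_def using assms by (intro sum.cong refl) auto

lemma positive_block_iff:
  "positive_block n (toeplitz_mat n \<tau>) \<longleftrightarrow> (\<forall>x. toeplitz_form n \<tau> x x \<in> \<real>\<^sub>\<ge>\<^sub>0)"
proof -
  have eq: "dsum_inner (block_apply (toeplitz_mat n \<tau>) v) v = toeplitz_form n \<tau> (($) v) (($) v)"
    for v
    by (simp add: dsum_inner_def block_apply_def toeplitz_mat_def toeplitz_form_def cinner_sum_left)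
  have "toeplitz_form n \<tau> x x = toeplitz_form n \<tau> (($) (vec n x)) (($) (vec n x))" for x
    by (rule toeplitz_form_cong) auto
  moreover have "vec n x \<in> carrier_vec n" for x :: "nat \<Rightarrow> 'a" by simp
  ultimately show ?thesis
    unfolding positive_block_def eq by metis
qed

lemma hermitian_form_swap:
  assumes "\<And>l x y. cinner (blinfun_apply (\<tau> l) x) y = cinner x (blinfun_apply (\<tau> (- l)) y)"
  shows "toeplitz_form n \<tau> x y = cnj (toeplitz_form n \<tau> y x)"
proof -
  have "cinner (blinfun_apply (\<tau> (int k - int j)) (x j)) (y k) =
      cnj (cinner (blinfun_apply (\<tau> (int j - int k)) (y k)) (x j))" for k j
    using assms[of "int k - int j" "x j" "y k"] by (metis cinner_commute minus_diff_eq)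
  then have "toeplitz_form n \<tau> x y =
      (\<Sum>k<n. \<Sum>j<n. cnj (cinner (blinfun_apply (\<tau> (int j - int k)) (y k)) (x j)))"
    unfolding toeplitz_form_def by simp
  also have "\<dots> = cnj (toeplitz_form n \<tau> y x)"
    unfolding toeplitz_form_def cnj_sum by (rule sum.swap)
  finally show ?thesis .
qed

text \<open>Polarisation: reality at \<open>x + y\<close> relates the imaginary parts, and reality
  at \<open>x + ?y\<close>, with \<open>y\<close> multiplied by the imaginary unit, the real
  parts.\<close>

lemma real_form_hermitian:
  assumes \<tau>: "\<And>l. \<tau> l \<in> bounded_operators" and real: "\<And>x. toeplitz_form n \<tau> x x \<in> \<real>"
  shows "toeplitz_form n \<tau> x y = cnj (toeplitz_form n \<tau> y x)"
proof -
  let ?y = "\<lambda>j. \<i> *\<^sub>C y j"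
  have "Im (toeplitz_form n \<tau> z z) = 0" for z
    using real by (simp add: complex_is_Real_iff)
  from this[of "x + y"] this[of "x + ?y"] this[of x] this[of y] show ?thesis
    by (simp add: toeplitz_form_add_left toeplitz_form_add_right toeplitz_form_scaleC_left[OF \<tau>]
        toeplitz_form_scaleC_right complex_eq_iff algebra_simps)
qed

lemma index_differenceE:
  assumes "\<bar>l\<bar> < int n"
  obtains i k where "i < n" "k < n" "l = int i - int k"
proof (cases "l \<ge> 0")
  case True
  then show ?thesis using that[of "nat l" 0] assms by auto
next
  case False
  then show ?thesis using that[of 0 "nat (- l)"] assms by auto
qed

lemma positive_hermitian:
  assumes \<tau>: "\<And>l. \<tau> l \<in> bounded_operators" and pos: "positive_block n (toeplitz_mat n \<tau>)"
    and l: "\<bar>l\<bar> < int n"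
  shows "cinner (blinfun_apply (\<tau> l) x) y = cinner x (blinfun_apply (\<tau> (- l)) y)"
proof -
  have real: "toeplitz_form n \<tau> z z \<in> \<real>" for z
    using pos by (metis positive_block_iff nonneg_Reals_subset_Reals subsetD)
  obtain i k where ik: "i < n" "k < n" "l = int i - int k"
    using index_differenceE[OF l] .
  from real_form_hermitian[OF \<tau> real, of "single k x" "single i y"] ik show ?thesis
    by (simp add: toeplitz_form_single) (metis cinner_commute complex_cnj_cnj)
qed

section \<open>One-step extension of a positive block Toeplitz matrix\<close>

definition supported :: "nat set \<Rightarrow> (nat \<Rightarrow> 'h::real_vector) set" where
  "supported S = {x. \<forall>j. j \<notin> S \<longrightarrow> x j = 0}"

lemma subspace_supported: "subspace (supported S)"
  by (rule subspaceI) (auto simp: supported_def)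

lemma supported_mono: "S \<subseteq> S' \<Longrightarrow> supported S \<subseteq> supported S'"
  by (auto simp: supported_def)

lemma single_supported: "i \<in> S \<Longrightarrow> single i x \<in> supported S"
  by (auto simp: supported_def single_def)

text \<open>In the locale below the unknown corner entries of the enlarged matrix are set to zero. The
  form of size \<open>n + 1\<close> is then positive on vectors supported in \<open>{0..n - 1}\<close> and on those
  supported in \<open>{1..n}\<close>.\<close>

locale positive_toeplitz =
  fixes n :: nat and \<tau> :: "int \<Rightarrow> 'h::chilbert_space \<Rightarrow>\<^sub>L 'h"
  assumes n: "n \<ge> 1"
    and ops: "\<And>l. \<tau> l \<in> bounded_operators"
    and outside: "\<And>l. \<bar>l\<bar> \<ge> int n \<Longrightarrow> \<tau> l = 0"
    and hermitian: "\<And>l x y. cinner (blinfun_apply (\<tau> l) x) y = cinner x (blinfun_apply (\<tau> (- l)) y)"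
    and positive: "\<And>x. toeplitz_form n \<tau> x x \<in> \<real>\<^sub>\<ge>\<^sub>0"
begin

section \<open>The enlarged form with zero corners and its two positive subspaces\<close>

abbreviation F :: "(nat \<Rightarrow> 'h) \<Rightarrow> (nat \<Rightarrow> 'h) \<Rightarrow> complex" where
  "F \<equiv> toeplitz_form (Suc n) \<tau>"

abbreviation D :: "(nat \<Rightarrow> 'h) set" where
  "D \<equiv> supported {1..<n}"

text \<open>\<open>X 0\<close> and \<open>X n\<close> belong to the first and the last
  \<open>n\<close> of the \<open>n + 1\<close> coordinates; \<open>D\<close> is their
  intersection.\<close>

abbreviation X :: "nat \<Rightarrow> (nat \<Rightarrow> 'h) set" where
  "X p \<equiv> supported (insert p {1..<n})"

definition row :: "nat \<Rightarrow> (nat \<Rightarrow> 'h) \<Rightarrow> 'h" where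
  "row q x = (\<Sum>j<Suc n. blinfun_apply (\<tau> (int q - int j)) (x j))"

sublocale symmetric_form "\<lambda>x y. Re (F x y)"
proof
  show "bilinear (\<lambda>x y. Re (F x y))"
    by (rule toeplitz_form_bilinear)
  show "Re (F x y) = Re (F y x)" for x y
    using hermitian_form_swap[of \<tau> "Suc n" x y, OF hermitian] by simp
qed

text \<open>Deleting the last row and column, or the first ones, leaves the given positive matrix
  both times, by the Toeplitz structure.\<close>

lemma psd_X:
  assumes p: "p = 0 \<or> p = n"
  shows "psd_on (X p)"
  unfolding psd_on_def
proof (intro conjI ballI subspace_supported)
  fix x assume x: "x \<in> X p"
  show "Re (F x x) \<ge> 0"
  proof (cases "x n = 0")
    case True
    then have "F x x = toeplitz_form n \<tau> x x"
      by (simp add: toeplitz_form_def)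
    then show ?thesis
      using positive[of x] by (simp add: complex_nonneg_Reals_iff)
  next
    case False
    then have "x 0 = 0"
      using x p n by (auto simp: supported_def)
    then have "F x x = toeplitz_form n \<tau> (x \<circ> Suc) (x \<circ> Suc)"
      by (simp add: toeplitz_form_def sum.lessThan_Suc_shift del: sum.lessThan_Suc)
    then show ?thesis
      using positive[of "x \<circ> Suc"] by (simp add: complex_nonneg_Reals_iff)
  qed
qed

lemma D_subset: "D \<subseteq> X p"
  by (intro supported_mono) auto

lemma F_single: "q \<le> n \<Longrightarrow> F x (single q y) = cinner (row q x) y"
  by (simp add: toeplitz_form_single_right row_def del: sum.lessThan_Suc)

lemma seminorm_single:
  assumes "p \<le> n"
  shows "seminorm (single p x) \<le> sqrt (norm (\<tau> 0)) * norm x"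
proof -
  have "Re (F (single p x) (single p x)) = Re (cinner (blinfun_apply (\<tau> 0) x) x)"
    using assms by (simp add: toeplitz_form_single)
  also have "\<dots> \<le> norm (blinfun_apply (\<tau> 0) x) * norm x"
    using Re_cinner_le[of "blinfun_apply (\<tau> 0) x" x] by linarith
  also have "\<dots> \<le> norm (\<tau> 0) * norm x * norm x"
    by (intro mult_right_mono norm_blinfun) simp
  finally have "seminorm (single p x) \<le> sqrt (norm (\<tau> 0) * norm x * norm x)"
    unfolding seminorm_def by (rule real_sqrt_le_mono)
  then show ?thesis
    by (simp add: real_sqrt_mult mult.assoc)
qed

text \<open>Cauchy-Schwarz against \<open>single q (row q x)\<close>, which is available because
  this vector and \<open>x\<close> both lie in \<open>X q\<close>. Hence \<open>row q\<close> is
  Lipschitz for the seminorm on \<open>D\<close>.\<close>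

lemma norm_row:
  assumes x: "x \<in> D" and q: "q = 0 \<or> q = n"
  shows "norm (row q x) \<le> sqrt (norm (\<tau> 0)) * seminorm x"
proof -
  let ?y = "row q x"
  have "q \<le> n" using q by auto
  have xX: "x \<in> X q" using x D_subset by auto
  have nn: "seminorm x \<ge> 0" by (rule seminorm_nonneg[OF psd_X[OF q] xX])
  have "norm ?y * norm ?y = Re (F x (single q ?y))"
    using \<open>q \<le> n\<close> by (simp add: F_single cinner_norm power2_eq_square)
  also have "\<dots> \<le> seminorm x * seminorm (single q ?y)"
    using cauchy_schwarz[OF psd_X[OF q] xX, of "single q ?y"] by (simp add: single_supported)
  also have "\<dots> \<le> seminorm x * (sqrt (norm (\<tau> 0)) * norm ?y)"
    using \<open>q \<le> n\<close> nn by (intro mult_left_mono seminorm_single)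
  finally have "norm ?y * norm ?y \<le> (sqrt (norm (\<tau> 0)) * seminorm x) * norm ?y"
    by (simp add: algebra_simps)
  then show ?thesis
    using nn by (cases "norm ?y = 0") (auto dest: mult_right_le_imp_le)
qed

section \<open>Corner operators as limits along approximate projections\<close>

lemma row_add: "row q (x + y) = row q x + row q y"
  by (simp add: row_def blinfun.add_right sum.distrib del: sum.lessThan_Suc)

lemma row_diff: "row q (x - y) = row q x - row q y"
  by (simp add: row_def blinfun.diff_right sum_subtractf del: sum.lessThan_Suc)

lemma row_scaleC: "row q (\<lambda>j. c *\<^sub>C x j) = c *\<^sub>C row q x"
  by (simp add: row_def bounded_operatorsD[OF ops] complex_vector.scale_sum_right del: sum.lessThan_Suc)

lemma supported_scaleC: "x \<in> supported S \<Longrightarrow> (\<lambda>j. c *\<^sub>C x j) \<in> supported S"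
  for x :: "nat \<Rightarrow> 'h"
  by (simp add: supported_def)

text \<open>The scalar \<open>c\<close> moves to the test vector as \<open>cnj c\<close>, and
  \<open>D\<close> is stable under complex scalars.\<close>

lemma approx_proj_scaleC:
  assumes "approx_proj D u d"
  shows "approx_proj D (\<lambda>j. c *\<^sub>C u j) (\<lambda>m j. c *\<^sub>C d m j)"
proof -
  obtain \<epsilon> where lim: "\<epsilon> \<longlonglongrightarrow> 0" and dD: "\<And>m. d m \<in> D"
    and le: "\<And>m e. e \<in> D \<Longrightarrow> \<bar>Re (F (u - d m) e)\<bar> \<le> \<epsilon> m * seminorm e"
    using assms unfolding approx_proj_def by metis
  have sn: "seminorm (\<lambda>j. a *\<^sub>C e j) = cmod a * seminorm e" for a e
  proof -
    have "F (\<lambda>j. a *\<^sub>C e j) (\<lambda>j. a *\<^sub>C e j) = (a * cnj a) * F e e"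
      by (simp add: toeplitz_form_scaleC_left[OF ops] toeplitz_form_scaleC_right)
    also have "\<dots> = of_real ((cmod a)\<^sup>2) * F e e"
      by (simp only: complex_norm_square)
    finally have "Re (F (\<lambda>j. a *\<^sub>C e j) (\<lambda>j. a *\<^sub>C e j)) = (cmod a)\<^sup>2 * Re (F e e)"
      by (simp only: Re_complex_of_real Im_complex_of_real times_complex.sel(1) mult_zero_left diff_0_right)
    then show ?thesis
      by (simp add: seminorm_def real_sqrt_mult)
  qed
  have "\<bar>Re (F ((\<lambda>j. c *\<^sub>C u j) - (\<lambda>j. c *\<^sub>C d m j)) e)\<bar> \<le> (cmod c * \<epsilon> m) * seminorm e"
    if e: "e \<in> D" for m e
  proof -
    let ?e = "\<lambda>j. cnj c *\<^sub>C e j"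
    have "(\<lambda>j. c *\<^sub>C u j) - (\<lambda>j. c *\<^sub>C d m j) = (\<lambda>j. c *\<^sub>C (u - d m) j)"
      by (simp add: fun_eq_iff complex_vector.scale_right_diff_distrib)
    then have "F ((\<lambda>j. c *\<^sub>C u j) - (\<lambda>j. c *\<^sub>C d m j)) e = F (u - d m) ?e"
      by (simp only: toeplitz_form_scaleC_left[OF ops] toeplitz_form_scaleC_right complex_cnj_cnj)
    then show ?thesis
      using le[OF supported_scaleC[OF e], of m "cnj c"] by (simp add: sn algebra_simps)
  qed
  moreover have "(\<lambda>m. cmod c * \<epsilon> m) \<longlonglongrightarrow> 0"
    using tendsto_mult_right_zero[OF lim] .
  ultimately show ?thesis
    unfolding approx_proj_def
    using dD by (auto intro!: supported_scaleC exI[of _ "\<lambda>m. cmod c * \<epsilon> m"])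
qed

text \<open>The sequence \<open>d\<close> is Cauchy for the seminorm but may lack a limit in
  \<open>D\<close>; its rows are Cauchy in the complete space and do converge.\<close>

lemma row_convergent:
  assumes q: "q = 0 \<or> q = n" and d: "approx_proj D u d"
  shows "convergent (\<lambda>m. row q (d m))"
proof -
  have dD: "d m \<in> D" for m
    using d by (simp add: approx_proj_def)
  obtain \<delta> where lim: "\<delta> \<longlonglongrightarrow> 0" and \<delta>: "\<And>m l. seminorm (d m - d l) \<le> \<delta> m + \<delta> l"
    using approx_proj_dist[OF psd_X[OF q] subspace_supported D_subset d d] by blast
  let ?C = "sqrt (norm (\<tau> 0))"
  have "Cauchy (\<lambda>m. row q (d m))"
  proof (rule CauchyI)
    fix r :: real assume "r > 0"
    have "(\<lambda>m. ?C * \<delta> m) \<longlonglongrightarrow> 0"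
      using tendsto_mult_right_zero[OF lim] .
    then obtain M where M: "\<And>m. m \<ge> M \<Longrightarrow> norm (?C * \<delta> m) < r / 2"
      using LIMSEQ_D[of "\<lambda>m. ?C * \<delta> m" 0 "r / 2"] \<open>r > 0\<close> by auto
    have "norm (row q (d m) - row q (d l)) < r" if "m \<ge> M" "l \<ge> M" for m l
    proof -
      have "norm (row q (d m) - row q (d l)) \<le> ?C * seminorm (d m - d l)"
        using norm_row[OF subspace_diff[OF subspace_supported dD dD] q, of m l]
        by (simp add: row_diff)
      also have "\<dots> \<le> ?C * (\<delta> m + \<delta> l)"
        by (intro mult_left_mono \<delta>) simp
      also have "\<dots> \<le> norm (?C * \<delta> m) + norm (?C * \<delta> l)"
        by (simp add: algebra_simps)
      also have "\<dots> < r"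
        using M[OF that(1)] M[OF that(2)] by linarith
      finally show ?thesis .
    qed
    then show "\<exists>M. \<forall>m\<ge>M. \<forall>l\<ge>M. norm (row q (d m) - row q (d l)) < r"
      by blast
  qed
  then show ?thesis
    by (rule Cauchy_convergent)
qed

text \<open>Independence of the chosen sequence is what makes the limit additive and homogeneous in
  \<open>u\<close>.\<close>

lemma row_limit_unique:
  assumes q: "q = 0 \<or> q = n" and d: "approx_proj D u d" and d': "approx_proj D u d'"
    and w: "(\<lambda>m. row q (d m)) \<longlonglongrightarrow> w" and w': "(\<lambda>m. row q (d' m)) \<longlonglongrightarrow> w'"
  shows "w = w'"
proof -
  have dD: "d m \<in> D" "d' m \<in> D" for m
    using d d' by (simp_all add: approx_proj_def)
  obtain \<delta> where lim: "\<delta> \<longlonglongrightarrow> 0" and \<delta>: "\<And>m l. seminorm (d m - d' l) \<le> \<delta> m + \<delta> l"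
    using approx_proj_dist[OF psd_X[OF q] subspace_supported D_subset d d'] by blast
  let ?C = "sqrt (norm (\<tau> 0))"
  have "norm (row q (d m) - row q (d' m)) \<le> ?C * (\<delta> m + \<delta> m)" for m
  proof -
    have "norm (row q (d m) - row q (d' m)) \<le> ?C * seminorm (d m - d' m)"
      using norm_row[OF subspace_diff[OF subspace_supported dD(1) dD(2)] q, of m m]
      by (simp add: row_diff)
    also have "\<dots> \<le> ?C * (\<delta> m + \<delta> m)"
      by (intro mult_left_mono \<delta>) simp
    finally show ?thesis .
  qed
  moreover have "(\<lambda>m. ?C * (\<delta> m + \<delta> m)) \<longlonglongrightarrow> 0"
    using tendsto_mult_right_zero[OF tendsto_add_zero[OF lim lim]] .
  ultimately have "(\<lambda>m. row q (d m) - row q (d' m)) \<longlonglongrightarrow> 0"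
    using Lim_null_comparison by (metis (mono_tags, lifting) always_eventually)
  then show ?thesis
    using LIMSEQ_unique[OF tendsto_diff[OF w w'], of 0] by simp
qed

text \<open>\<open>N x\<close> is row \<open>q\<close> of the projection of
  \<open>single p x\<close>. Its norm is at most \<open>norm (\<tau> 0) * norm x\<close>: the
  seminorm of \<open>single p x\<close> and the bound on \<open>row q\<close> each contribute a
  factor \<open>sqrt (norm (\<tau> 0))\<close>.\<close>

lemma corner_operator:
  assumes p: "p = 0 \<or> p = n" and q: "q = 0 \<or> q = n"
  shows "\<exists>N\<in>bounded_operators. \<forall>x. \<exists>d. approx_proj D (single p x) d \<and>
    (\<lambda>m. row q (d m)) \<longlonglongrightarrow> blinfun_apply N x"
proof -
  have pX: "single p x \<in> X p" for x
    by (simp add: single_supported)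
  have "\<exists>d w. approx_proj D (single p x) d \<and> (\<lambda>m. row q (d m)) \<longlonglongrightarrow> w" for x
  proof -
    obtain d where d: "approx_proj D (single p x) d"
      using approx_proj_exists[OF psd_X[OF p] subspace_supported D_subset pX] by blast
    from row_convergent[OF q d] d show ?thesis
      by (auto simp: convergent_def)
  qed
  then obtain d f where d: "\<And>x. approx_proj D (single p x) (d x)"
    and f: "\<And>x. (\<lambda>m. row q (d x m)) \<longlonglongrightarrow> f x"
    by metis
  have add: "f (x + y) = f x + f y" for x y
  proof (rule row_limit_unique[OF q d _ f])
    show "approx_proj D (single p (x + y)) (\<lambda>m. d x m + d y m)"
      unfolding single_add by (intro approx_proj_add subspace_supported d)
    show "(\<lambda>m. row q (d x m + d y m)) \<longlonglongrightarrow> f x + f y"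
      unfolding row_add by (intro tendsto_add f)
  qed
  have scale: "f (c *\<^sub>C x) = c *\<^sub>C f x" for c x
  proof (rule row_limit_unique[OF q d _ f])
    show "approx_proj D (single p (c *\<^sub>C x)) (\<lambda>m j. c *\<^sub>C d x m j)"
      unfolding single_scaleC by (intro approx_proj_scaleC d)
    have "bounded_linear (\<lambda>y::'h. c *\<^sub>C y)"
      by (rule bounded_linear_intro[where K = "cmod c"])
        (simp_all add: scaleC_add_right scaleR_scaleC scaleC_scaleC norm_scaleC mult.commute)
    from bounded_linear.tendsto[OF this f]
    show "(\<lambda>m. row q (\<lambda>j. c *\<^sub>C d x m j)) \<longlonglongrightarrow> c *\<^sub>C f x"
      unfolding row_scaleC .
  qed
  have bound: "norm (f x) \<le> norm x * norm (\<tau> 0)" for x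
  proof -
    let ?C = "sqrt (norm (\<tau> 0))"
    obtain \<epsilon> where lim: "\<epsilon> \<longlonglongrightarrow> 0" and \<epsilon>: "\<And>m. seminorm (d x m) \<le> seminorm (single p x) + \<epsilon> m"
      using approx_proj_bounded[OF psd_X[OF p] D_subset pX d] by blast
    have "norm (row q (d x m)) \<le> ?C * (?C * norm x + \<epsilon> m)" for m
    proof -
      have "norm (row q (d x m)) \<le> ?C * seminorm (d x m)"
        using d by (intro norm_row q) (simp add: approx_proj_def)
      also have "seminorm (d x m) \<le> ?C * norm x + \<epsilon> m"
        using \<epsilon>[of m] seminorm_single[of p x] p by auto
      finally show ?thesis
        by (simp add: mult_left_mono)
    qed
    moreover have "(\<lambda>m. ?C * (?C * norm x + \<epsilon> m)) \<longlonglongrightarrow> ?C * (?C * norm x + 0)"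
      by (intro tendsto_intros lim)
    ultimately have "norm (f x) \<le> ?C * (?C * norm x + 0)"
      using LIMSEQ_le[OF tendsto_norm[OF f]] by blast
    also have "\<dots> = norm x * (?C * ?C)"
      by (simp only: add_0_right mult_ac)
    finally show ?thesis by simp
  qed
  obtain N where "N \<in> bounded_operators" "blinfun_apply N = f"
    using bounded_operatorsI[OF add scale bound] by blast
  then show ?thesis
    using d f by (intro bexI[of _ N]) auto
qed

text \<open>The corner entry is the pairing of both projections, since \<open>single q y\<close> may
  be replaced by \<open>d' m\<close> when paired with the bounded sequence in \<open>D\<close>. This
  symmetric description gives the adjoint.\<close>

lemma corner_limit:
  assumes p: "p = 0 \<or> p = n" and q: "q = 0 \<or> q = n"
    and d: "approx_proj D (single p x) d" and w: "(\<lambda>m. row q (d m)) \<longlonglongrightarrow> w"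
    and d': "approx_proj D (single q y) d'"
  shows "(\<lambda>m. Re (F (d m) (d' m))) \<longlonglongrightarrow> Re (cinner w y)"
proof -
  have dD: "d m \<in> D" for m
    using d by (simp add: approx_proj_def)
  have "q \<le> n" using q by auto
  obtain K where K: "\<And>m. seminorm (d m) \<le> K"
    using approx_proj_bounded'[OF psd_X[OF p] D_subset _ d] by (auto simp: single_supported)
  have "(\<lambda>m. Re (cinner (row q (d m)) y) - Re (F (single q y - d' m) (d m)))
      \<longlonglongrightarrow> Re (cinner w y) - 0"
    by (intro tendsto_diff tendsto_Re_cinner w
        approx_proj_residual[OF psd_X[OF q] D_subset _ d' dD K]) (simp add: single_supported)
  moreover have "Re (cinner (row q (d m)) y) - Re (F (single q y - d' m) (d m)) =
      Re (F (d m) (d' m))" for m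
    using \<open>q \<le> n\<close> by (simp add: expand sym[of "single q y" "d m"] sym[of "d' m" "d m"] F_single)
  ultimately show ?thesis by simp
qed

section \<open>Assembling the extension\<close>

lemma extension_exists:
  "\<exists>\<tau>'. (\<forall>l. \<tau>' l \<in> bounded_operators) \<and> (\<forall>l. \<bar>l\<bar> < int n \<longrightarrow> \<tau>' l = \<tau> l) \<and>
    (\<forall>x. toeplitz_form (Suc n) \<tau>' x x \<in> \<real>\<^sub>\<ge>\<^sub>0)"
proof -
  obtain N where N: "N \<in> bounded_operators"
    and Nlim: "\<And>x. \<exists>d. approx_proj D (single 0 x) d \<and> (\<lambda>m. row n (d m)) \<longlonglongrightarrow> blinfun_apply N x"
    using corner_operator[of 0 n] by auto
  obtain N' where N': "N' \<in> bounded_operators"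
    and N'lim: "\<And>x. \<exists>d. approx_proj D (single n x) d \<and> (\<lambda>m. row 0 (d m)) \<longlonglongrightarrow> blinfun_apply N' x"
    using corner_operator[of n 0] by auto
  \<comment> \<open>By symmetry of the form both sides are limits of the same sequence, so
    \<open>N'\<close> is the adjoint of \<open>N\<close>.\<close>
  have Re_adj: "Re (cinner (blinfun_apply N x) y) = Re (cinner x (blinfun_apply N' y))" for x y
  proof -
    obtain d where d: "approx_proj D (single 0 x) d" "(\<lambda>m. row n (d m)) \<longlonglongrightarrow> blinfun_apply N x"
      using Nlim by blast
    obtain d' where d': "approx_proj D (single n y) d'" "(\<lambda>m. row 0 (d' m)) \<longlonglongrightarrow> blinfun_apply N' y"
      using N'lim by blast
    have "(\<lambda>m. Re (F (d m) (d' m))) \<longlonglongrightarrow> Re (cinner (blinfun_apply N x) y)"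
      by (rule corner_limit[OF _ _ d d'(1)]) auto
    moreover have "(\<lambda>m. Re (F (d' m) (d m))) \<longlonglongrightarrow> Re (cinner (blinfun_apply N' y) x)"
      by (rule corner_limit[OF _ _ d' d(1)]) auto
    ultimately show ?thesis
      unfolding sym[of "d' _" "d _"] cinner_form.sym[of x] by (rule LIMSEQ_unique)
  qed
  have adj: "cinner (blinfun_apply N x) y = cinner x (blinfun_apply N' y)" for x y
    using Re_adj[of x y] Re_adj[of x "\<i> *\<^sub>C y"]
    by (simp add: complex_eq_iff cinner_scaleC_right bounded_operatorsD[OF N'])
  \<comment> \<open>Row \<open>n\<close> and column 0 differ by \<open>int n\<close>; since
    \<open>n \<ge> 1\<close>, the two updates do not collide.\<close>
  define \<tau>' where "\<tau>' = \<tau>(int n := N, - int n := N')"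
  have herm': "cinner (blinfun_apply (\<tau>' l) x) y = cinner x (blinfun_apply (\<tau>' (- l)) y)" for l x y
  proof -
    consider "l = int n" | "l = - int n" | "l \<noteq> int n" "l \<noteq> - int n" by blast
    then show ?thesis
    proof cases
      case 2
      have "cinner (blinfun_apply N' x) y = cinner x (blinfun_apply N y)"
        using adj[of y x] by (metis cinner_commute)
      with 2 show ?thesis using n by (simp add: \<tau>'_def)
    qed (use n in \<open>simp_all add: \<tau>'_def adj hermitian\<close>)
  qed
  have "Re (toeplitz_form (Suc n) \<tau>' z z) \<ge> 0" for z
  proof -
    obtain d where d: "approx_proj D (single 0 (z 0)) d"
      and lim: "(\<lambda>m. row n (d m)) \<longlonglongrightarrow> blinfun_apply N (z 0)"
      using Nlim by blast
    \<comment> \<open>The vector \<open>z\<close> splits into its coordinate 0, in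
      \<open>X 0\<close>, and the rest, in \<open>X n\<close>.\<close>
    define u where "u = single 0 (z 0)"
    define e where "e = (\<lambda>j. if j \<in> {1..<n} then z j else 0)"
    define v where "v = e + single n (z n)"
    have eD: "e \<in> D" by (simp add: e_def supported_def)
    have uX: "u \<in> X 0" by (simp add: u_def single_supported)
    have vX: "v \<in> X n"
      unfolding v_def using eD D_subset by (intro subspace_add subspace_supported single_supported) auto
    have du: "approx_proj D u d" using d by (simp add: u_def)
    have dD: "d m \<in> D" for m
      using d by (simp add: approx_proj_def)
    \<comment> \<open>Against \<open>e\<close> in \<open>D\<close> the projection of
      \<open>u\<close> pairs like \<open>u\<close> in the limit; against coordinate \<open>n\<close>
      it produces the new entry \<open>N\<close>.\<close>
    have "(\<lambda>m. Re (F u e) - Re (F (u - d m) e) + Re (cinner (row n (d m)) (z n)))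
        \<longlonglongrightarrow> Re (F u e) - 0 + Re (cinner (blinfun_apply N (z 0)) (z n))"
      by (intro tendsto_intros approx_proj_residual[OF psd_X D_subset uX du eD order_refl]
          tendsto_Re_cinner lim) simp
    moreover have "Re (F u e) - Re (F (u - d m) e) + Re (cinner (row n (d m)) (z n)) = Re (F (d m) v)"
      for m
      by (simp add: v_def expand F_single)
    moreover have "Re (F u (single n (z n))) = 0"
      by (simp add: u_def toeplitz_form_single outside)
    then have "Re (F u e) = Re (F u v)"
      by (simp add: v_def expand)
    ultimately have c: "(\<lambda>m. Re (F (d m) v)) \<longlonglongrightarrow> Re (F u v) + Re (cinner (blinfun_apply N (z 0)) (z n))"
      by simp
    have "0 \<le> Re (F u u) + Re (F v v) + 2 * (Re (F u v) + Re (cinner (blinfun_apply N (z 0)) (z n)))"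
      by (rule completion_nonneg[OF psd_X psd_X subspace_supported D_subset D_subset uX vX du c]) auto
    also have "\<dots> = Re (F (u + v) (u + v)) + 2 * Re (cinner (blinfun_apply N (z 0)) (z n))"
      by (simp add: expand sym[of v u])
    also have "F (u + v) (u + v) = F z z"
      using n by (intro toeplitz_form_cong) (auto simp: u_def v_def e_def single_def)
    also have "Re (F z z) + 2 * Re (cinner (blinfun_apply N (z 0)) (z n)) =
        Re (toeplitz_form (Suc n) \<tau>' z z)"
    proof -
      \<comment> \<open>The two matrices differ only at the corners \<open>(n, 0)\<close> and
        \<open>(0, n)\<close>.\<close>
      have "toeplitz_form (Suc n) \<tau>' z z - F z z =
          (\<Sum>k<Suc n. \<Sum>j<Suc n. cinner (blinfun_apply (\<tau>' (int k - int j) - \<tau> (int k - int j)) (z j)) (z k))"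
        by (simp add: toeplitz_form_def blinfun.diff_left cinner_diff_left sum_subtractf del: sum.lessThan_Suc)
      also have "\<dots> = (\<Sum>k<Suc n. \<Sum>j<Suc n.
          (if j = 0 then if k = n then cinner (blinfun_apply N (z 0)) (z n) else 0 else 0) +
          (if j = n then if k = 0 then cinner (blinfun_apply N' (z n)) (z 0) else 0 else 0))"
        using n by (intro sum.cong refl) (auto simp: \<tau>'_def outside)
      also have "\<dots> = cinner (blinfun_apply N (z 0)) (z n) + cinner (blinfun_apply N' (z n)) (z 0)"
        by (simp add: sum.distrib del: sum.lessThan_Suc)
      finally have "Re (toeplitz_form (Suc n) \<tau>' z z) - Re (F z z) =
          Re (cinner (blinfun_apply N (z 0)) (z n)) + Re (cinner (blinfun_apply N' (z n)) (z 0))"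
        by (metis minus_complex.sel(1) plus_complex.sel(1))
      then show ?thesis
        using Re_adj[of "z 0" "z n"] cinner_form.sym[of "blinfun_apply N' (z n)" "z 0"] by linarith
    qed
    finally show ?thesis .
  qed
  moreover have "Im (toeplitz_form (Suc n) \<tau>' z z) = 0" for z
    using hermitian_form_swap[of \<tau>' "Suc n" z z, OF herm'] by (simp add: complex_eq_iff)
  ultimately have "toeplitz_form (Suc n) \<tau>' z z \<in> \<real>\<^sub>\<ge>\<^sub>0" for z
    by (simp add: complex_nonneg_Reals_iff)
  moreover have "\<tau>' l \<in> bounded_operators" for l
    using N N' ops by (simp add: \<tau>'_def)
  ultimately show ?thesis
    by (intro exI[of _ \<tau>']) (auto simp: \<tau>'_def)
qed

end

theorem one_step_extension:
  fixes \<tau> :: "int \<Rightarrow> 'h::chilbert_space \<Rightarrow>\<^sub>L 'h"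
  assumes n: "n \<ge> 1" and \<tau>: "\<And>l. \<tau> l \<in> bounded_operators"
    and pos: "positive_block n (toeplitz_mat n \<tau>)"
  shows "\<exists>\<tau>'. (\<forall>l. \<tau>' l \<in> bounded_operators) \<and> (\<forall>l. \<bar>l\<bar> < int n \<longrightarrow> \<tau>' l = \<tau> l) \<and>
    positive_block (Suc n) (toeplitz_mat (Suc n) \<tau>')"
proof -
  \<comment> \<open>Truncation makes the corners zero and the Hermitian relation valid at every
    integer, as \<open>positive_toeplitz\<close> demands; \<open>positive_hermitian\<close> supplies
    it for \<open>\<bar>l\<bar> < int n\<close>.\<close>
  define \<sigma> where "\<sigma> l = (if \<bar>l\<bar> < int n then \<tau> l else 0)" for l
  interpret positive_toeplitz n \<sigma>
  proof
    show "cinner (blinfun_apply (\<sigma> l) x) y = cinner x (blinfun_apply (\<sigma> (- l)) y)" for l x y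
      using positive_hermitian[OF \<tau> pos] by (simp add: \<sigma>_def)
    show "toeplitz_form n \<sigma> x x \<in> \<real>\<^sub>\<ge>\<^sub>0" for x
      using pos toeplitz_form_cong[of n \<sigma> \<tau> x x x x] by (simp add: positive_block_iff \<sigma>_def)
  qed (use n \<tau> bounded_operators_zero in \<open>auto simp: \<sigma>_def\<close>)
  from extension_exists show ?thesis
    by (auto simp: positive_block_iff \<sigma>_def)
qed

section \<open>Block Toeplitz matrices and purity\<close>

lemma toeplitz_mat_eq_iff:
  "toeplitz_mat n \<sigma> = toeplitz_mat n \<tau> \<longleftrightarrow> (\<forall>l. \<bar>l\<bar> < int n \<longrightarrow> \<sigma> l = \<tau> l)"
proof
  assume eq: "toeplitz_mat n \<sigma> = toeplitz_mat n \<tau>"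
  show "\<forall>l. \<bar>l\<bar> < int n \<longrightarrow> \<sigma> l = \<tau> l"
  proof (intro allI impI)
    fix l assume l: "\<bar>l\<bar> < int n"
    \<comment> \<open>One of \<open>nat l\<close> and \<open>nat (- l)\<close> is 0, so the entry
      lies in the first row or column.\<close>
    have entry: "toeplitz_mat n \<rho> $$ (nat l, nat (- l)) = \<rho> l" for \<rho> :: "int \<Rightarrow> 'a"
    proof -
      have "int (nat l) - int (nat (- l)) = l" "nat l < n" "nat (- l) < n"
        using l by auto
      then show ?thesis
        by (simp add: toeplitz_mat_def)
    qed
    show "\<sigma> l = \<tau> l"
      using entry[of \<sigma>] entry[of \<tau>] eq by simp
  qed
qed (auto simp: toeplitz_mat_def intro!: eq_matI)

lemma toeplitz_mat_add:
  "toeplitz_mat n \<sigma> + toeplitz_mat n \<tau> = toeplitz_mat n (\<lambda>l. \<sigma> l + \<tau> l)"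
  by (auto simp: toeplitz_mat_def)

lemma map_toeplitz_mat: "map_mat f (toeplitz_mat n \<tau>) = toeplitz_mat n (\<lambda>l. f (\<tau> l))"
  by (auto simp: toeplitz_mat_def)

lemma T_mat_tensor:
  "T_mat n z \<otimes>\<^sub>o A = toeplitz_mat n (\<lambda>l. scaleC_operator (z powi l) A)"
  by (simp add: tensor_op_def T_mat_def map_toeplitz_mat)

lemma toeplitz_cone_iff:
  assumes "\<And>l. \<tau> l \<in> bounded_operators"
  shows "toeplitz_mat n \<tau> \<in> toeplitz_cone n \<longleftrightarrow> (\<forall>x. toeplitz_form n \<tau> x x \<in> \<real>\<^sub>\<ge>\<^sub>0)"
  using assms by (auto simp: toeplitz_cone_def toeplitz_tensor_def simp flip: positive_block_iff)

lemma toeplitz_coneE: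
  assumes "T \<in> toeplitz_cone n"
  obtains \<tau> where "T = toeplitz_mat n \<tau>" "\<And>l. \<tau> l \<in> bounded_operators"
    "\<And>x. toeplitz_form n \<tau> x x \<in> \<real>\<^sub>\<ge>\<^sub>0"
  using assms by (auto simp: toeplitz_cone_def toeplitz_tensor_def positive_block_iff)

text \<open>Purity read on symbols, of which the matrix sees only the coefficients with
  \<open>\<bar>l\<bar> < int n\<close>.\<close>

lemma pure_toeplitzD:
  assumes pure: "pure_element (toeplitz_cone n) (toeplitz_mat n \<tau>)"
    and ops: "\<And>l. \<sigma> l \<in> bounded_operators" "\<And>l. \<rho> l \<in> bounded_operators"
    and pos: "\<And>x. toeplitz_form n \<sigma> x x \<in> \<real>\<^sub>\<ge>\<^sub>0" "\<And>x. toeplitz_form n \<rho> x x \<in> \<real>\<^sub>\<ge>\<^sub>0"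
    and sum: "\<And>l. \<bar>l\<bar> < int n \<Longrightarrow> \<sigma> l + \<rho> l = \<tau> l"
  shows "\<exists>s. \<forall>l. \<bar>l\<bar> < int n \<longrightarrow> \<sigma> l = s *\<^sub>R \<tau> l"
proof -
  have "toeplitz_mat n \<sigma> \<in> toeplitz_cone n" "toeplitz_mat n \<rho> \<in> toeplitz_cone n"
    using ops pos by (simp_all add: toeplitz_cone_iff)
  moreover have "toeplitz_mat n \<sigma> + toeplitz_mat n \<rho> = toeplitz_mat n \<tau>"
    using sum by (simp add: toeplitz_mat_add toeplitz_mat_eq_iff)
  ultimately obtain s where "toeplitz_mat n \<sigma> = map_mat (scaleR s) (toeplitz_mat n \<tau>)"
    using pure unfolding pure_element_def by blast
  then show ?thesis
    by (auto simp: map_toeplitz_mat toeplitz_mat_eq_iff)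
qed

section \<open>Perturbation by the shift\<close>

lemma sum_lessThan_Suc_drop_last:
  "f n = 0 \<Longrightarrow> (\<Sum>j<Suc n. f j) = (\<Sum>j<n. f j :: 'a::comm_monoid_add)"
  by simp

lemma sum_lessThan_Suc_drop_first:
  "f 0 = 0 \<Longrightarrow> (\<Sum>j<Suc n. f j) = (\<Sum>j<n. f (Suc j) :: 'a::comm_monoid_add)"
  by (simp add: sum.lessThan_Suc_shift del: sum.lessThan_Suc)

definition shift :: "(nat \<Rightarrow> 'h::zero) \<Rightarrow> nat \<Rightarrow> 'h" where
  "shift x = case_nat 0 x"

lemma shift_simps [simp]: "shift x 0 = 0" "shift x (Suc j) = x j"
  by (simp_all add: shift_def)

text \<open>A zero last entry leaves room for the shift. Shifting both arguments preserves index
  differences; shifting one of them translates the symbol by one.\<close>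

lemma toeplitz_form_shift:
  assumes "x n = 0" "y n = 0"
  shows "toeplitz_form (Suc n) \<tau> x y = toeplitz_form n \<tau> x y"
    and "toeplitz_form (Suc n) \<tau> (shift x) y = toeplitz_form n (\<lambda>l. \<tau> (l - 1)) x y"
    and "toeplitz_form (Suc n) \<tau> x (shift y) = toeplitz_form n (\<lambda>l. \<tau> (l + 1)) x y"
    and "toeplitz_form (Suc n) \<tau> (shift x) (shift y) = toeplitz_form n \<tau> x y"
  using assms
  by (simp_all add: toeplitz_form_def sum_lessThan_Suc_drop_last sum_lessThan_Suc_drop_first
      algebra_simps del: sum.lessThan_Suc)

text \<open>The symbol of \<open>shift_pert a \<tau>\<close> is that of \<open>\<tau>\<close> multiplied by
  \<open>\<bar>1 + a z\<bar>\<^sup>2 / 4\<close>, up to the orientation of \<open>z\<close>.\<close>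

definition shift_pert ::
    "complex \<Rightarrow> (int \<Rightarrow> 'h::chilbert_space \<Rightarrow>\<^sub>L 'h) \<Rightarrow> int \<Rightarrow> 'h \<Rightarrow>\<^sub>L 'h" where
  "shift_pert a \<tau> l = (1 / 4) *\<^sub>R (2 *\<^sub>R \<tau> l + scaleC_operator a (\<tau> (l - 1)) +
    scaleC_operator (cnj a) (\<tau> (l + 1)))"

lemma shift_pert_ops:
  assumes "\<And>l. \<tau> l \<in> bounded_operators"
  shows "shift_pert a \<tau> l \<in> bounded_operators"
  unfolding shift_pert_def
  by (intro bounded_operators_add bounded_operators_scaleR bounded_operators_scaleC assms)

lemma shift_pert_sum: "shift_pert a \<tau> l + shift_pert (- a) \<tau> l = \<tau> l"
  by (rule blinfun_eqI)
    (simp add: shift_pert_def blinfun.add_left blinfun.scaleR_left scaleC_operator.rep_eq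
      algebra_simps complex_vector.scale_minus_left flip: scaleR_add_left)

text \<open>The extended form at \<open>y + ?s\<close>, that is, \<open>y\<close> plus
  \<open>a\<close> times its shift, is four times the perturbed form. The size \<open>n + 1\<close>
  enters because \<open>shift_pert\<close> at \<open>\<bar>l\<bar> < int n\<close> involves
  coefficients up to \<open>\<plusminus> n\<close>.\<close>

lemma shift_pert_positive:
  assumes \<tau>: "\<And>l. \<tau> l \<in> bounded_operators" and pos: "\<And>x. toeplitz_form (Suc n) \<tau> x x \<in> \<real>\<^sub>\<ge>\<^sub>0"
    and a: "cmod a = 1"
  shows "toeplitz_form n (shift_pert a \<tau>) x x \<in> \<real>\<^sub>\<ge>\<^sub>0"
proof -
  define y where "y j = (if j < n then x j else 0)" for j
  let ?s = "\<lambda>j. a *\<^sub>C shift y j"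
  have y: "y n = 0" by (simp add: y_def)
  have aa: "a * cnj a = 1"
    using a by (simp flip: complex_norm_square)
  have "toeplitz_form (Suc n) \<tau> (y + ?s) (y + ?s) =
      toeplitz_form (Suc n) \<tau> y y + cnj a * toeplitz_form (Suc n) \<tau> y (shift y) +
      a * toeplitz_form (Suc n) \<tau> (shift y) y +
      a * cnj a * toeplitz_form (Suc n) \<tau> (shift y) (shift y)"
    by (simp add: toeplitz_form_add_left toeplitz_form_add_right toeplitz_form_scaleC_left[OF \<tau>]
        toeplitz_form_scaleC_right algebra_simps)
  also have "\<dots> = 2 * toeplitz_form n \<tau> y y + cnj a * toeplitz_form n (\<lambda>l. \<tau> (l + 1)) y y +
      a * toeplitz_form n (\<lambda>l. \<tau> (l - 1)) y y"
    by (simp add: toeplitz_form_shift[where x = y and y = y and n = n, OF y y] aa)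
  also have "\<dots> = 4 * toeplitz_form n (shift_pert a \<tau>) y y"
    by (simp add: toeplitz_form_def shift_pert_def blinfun.add_left blinfun.scaleR_left
        scaleC_operator.rep_eq cinner_simps sum.distrib sum_distrib_left algebra_simps)
  also have "toeplitz_form n (shift_pert a \<tau>) y y = toeplitz_form n (shift_pert a \<tau>) x x"
    by (intro toeplitz_form_cong) (auto simp: y_def)
  finally have eq: "toeplitz_form (Suc n) \<tau> (y + ?s) (y + ?s) = 4 * toeplitz_form n (shift_pert a \<tau>) x x" .
  from pos[of "y + ?s"] show ?thesis
    unfolding eq by (simp add: complex_nonneg_Reals_iff)
qed

text \<open>Purity is applied to the splitting into the perturbations by \<open>a\<close> and
  \<open>- a\<close>; solving for the neighbouring coefficients gives the constant
  \<open>4 * s - 2\<close>.\<close>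

lemma pure_shift_relation:
  assumes pure: "pure_element (toeplitz_cone n) (toeplitz_mat n \<tau>)"
    and \<tau>: "\<And>l. \<tau> l \<in> bounded_operators" and pos: "\<And>x. toeplitz_form (Suc n) \<tau> x x \<in> \<real>\<^sub>\<ge>\<^sub>0"
    and a: "cmod a = 1"
  shows "\<exists>c::real. \<forall>l x. \<bar>l\<bar> < int n \<longrightarrow>
    a *\<^sub>C blinfun_apply (\<tau> (l - 1)) x + cnj a *\<^sub>C blinfun_apply (\<tau> (l + 1)) x =
    c *\<^sub>R blinfun_apply (\<tau> l) x"
proof -
  have a': "cmod (- a) = 1" using a by simp
  obtain s where s: "\<And>l. \<bar>l\<bar> < int n \<Longrightarrow> shift_pert a \<tau> l = s *\<^sub>R \<tau> l"
    using pure_toeplitzD[OF pure shift_pert_ops[OF \<tau>] shift_pert_ops[OF \<tau>]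
        shift_pert_positive[OF \<tau> pos a] shift_pert_positive[OF \<tau> pos a'] shift_pert_sum]
    by blast
  have "a *\<^sub>C blinfun_apply (\<tau> (l - 1)) x + cnj a *\<^sub>C blinfun_apply (\<tau> (l + 1)) x =
      (4 * s - 2) *\<^sub>R blinfun_apply (\<tau> l) x" if "\<bar>l\<bar> < int n" for l x
  proof -
    let ?w = "a *\<^sub>C blinfun_apply (\<tau> (l - 1)) x + cnj a *\<^sub>C blinfun_apply (\<tau> (l + 1)) x"
    have "4 *\<^sub>R blinfun_apply (shift_pert a \<tau> l) x = 2 *\<^sub>R blinfun_apply (\<tau> l) x + ?w"
      by (simp add: shift_pert_def blinfun.add_left blinfun.scaleR_left scaleC_operator.rep_eq)
    then have "2 *\<^sub>R blinfun_apply (\<tau> l) x + ?w = (4 * s) *\<^sub>R blinfun_apply (\<tau> l) x"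
      by (simp add: s[OF that] blinfun.scaleR_left)
    then show ?thesis
      by (simp add: scaleR_diff_left eq_diff_eq add.commute)
  qed
  then show ?thesis by blast
qed

lemma pure_geometric:
  assumes n: "n \<ge> 1" and pure: "pure_element (toeplitz_cone n) (toeplitz_mat n \<tau>)"
    and \<tau>: "\<And>l. \<tau> l \<in> bounded_operators" and pos: "\<And>x. toeplitz_form (Suc n) \<tau> x x \<in> \<real>\<^sub>\<ge>\<^sub>0"
  shows "\<exists>\<mu>. cmod \<mu> = 1 \<and> (\<forall>l. \<bar>l\<bar> < int n \<longrightarrow> \<tau> l = scaleC_operator (\<mu> powi l) (\<tau> 0))"
proof -
  obtain c where c: "\<And>l x. \<bar>l\<bar> < int n \<Longrightarrow>
      blinfun_apply (\<tau> (l - 1)) x + blinfun_apply (\<tau> (l + 1)) x = c *\<^sub>R blinfun_apply (\<tau> l) x"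
    using pure_shift_relation[OF pure \<tau> pos, of 1] by (auto simp: scaleC_one)
  obtain c' where c': "\<And>l x. \<bar>l\<bar> < int n \<Longrightarrow>
      \<i> *\<^sub>C blinfun_apply (\<tau> (l - 1)) x + (- \<i>) *\<^sub>C blinfun_apply (\<tau> (l + 1)) x =
      c' *\<^sub>R blinfun_apply (\<tau> l) x"
    using pure_shift_relation[OF pure \<tau> pos, of \<i>] by auto
  \<comment> \<open>The two relations give \<open>c\<close> for the sum of the neighbours and, after
    multiplication by the imaginary unit, \<open>\<i> * c'\<close> for
    \<open>\<tau> (l + 1) - \<tau> (l - 1)\<close>. Half of \<open>c + \<i> * c'\<close> is the
    ratio.\<close>
  define \<mu> where "\<mu> = Complex (c / 2) (c' / 2)"
  have step: "blinfun_apply (\<tau> (l + 1)) x = \<mu> *\<^sub>C blinfun_apply (\<tau> l) x"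
    "blinfun_apply (\<tau> (l - 1)) x = cnj \<mu> *\<^sub>C blinfun_apply (\<tau> l) x" if l: "\<bar>l\<bar> < int n" for l x
  proof -
    let ?p = "blinfun_apply (\<tau> (l + 1)) x" and ?m = "blinfun_apply (\<tau> (l - 1)) x"
    let ?t = "blinfun_apply (\<tau> l) x"
    have sum: "?m + ?p = of_real c *\<^sub>C ?t"
      using c[OF l] by (simp add: scaleR_scaleC)
    have "\<i> *\<^sub>C (\<i> *\<^sub>C ?m + (- \<i>) *\<^sub>C ?p) = (\<i> * of_real c') *\<^sub>C ?t"
      unfolding c'[OF l] by (simp add: scaleR_scaleC scaleC_scaleC)
    then have diff: "?p - ?m = (\<i> * of_real c') *\<^sub>C ?t"
      by (simp add: complex_vector.scale_right_diff_distrib scaleC_scaleC scaleC_one)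
    have half: "(1 / 2) *\<^sub>C (w + w) = w" for w :: 'a
    proof -
      have "(1 / 2) *\<^sub>C (w + w) = (1 / 2 + 1 / 2) *\<^sub>C w"
        by (simp only: scaleC_add_left scaleC_add_right)
      then show ?thesis by (simp add: scaleC_one)
    qed
    have pm: "(?m + ?p) + (?p - ?m) = ?p + ?p" "(?m + ?p) - (?p - ?m) = ?m + ?m"
      by simp_all
    have "?p = (1 / 2) *\<^sub>C ((?m + ?p) + (?p - ?m))"
      by (simp only: half pm)
    also have "\<dots> = (1 / 2 * (of_real c + \<i> * of_real c')) *\<^sub>C ?t"
      unfolding sum diff by (simp add: scaleC_scaleC flip: scaleC_add_left)
    also have "1 / 2 * (of_real c + \<i> * of_real c') = \<mu>"
      by (simp add: \<mu>_def complex_eq_iff)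
    finally show "?p = \<mu> *\<^sub>C ?t" .
    have "?m = (1 / 2) *\<^sub>C ((?m + ?p) - (?p - ?m))"
      by (simp only: half pm)
    also have "\<dots> = (1 / 2 * (of_real c - \<i> * of_real c')) *\<^sub>C ?t"
      unfolding sum diff by (simp add: scaleC_scaleC flip: complex_vector.scale_left_diff_distrib)
    also have "1 / 2 * (of_real c - \<i> * of_real c') = cnj \<mu>"
      by (simp add: \<mu>_def complex_eq_iff)
    finally show "?m = cnj \<mu> *\<^sub>C ?t" .
  qed
  have pos_power: "blinfun_apply (\<tau> (int m)) x = \<mu> ^ m *\<^sub>C blinfun_apply (\<tau> 0) x"
    and neg_power: "blinfun_apply (\<tau> (- int m)) x = cnj \<mu> ^ m *\<^sub>C blinfun_apply (\<tau> 0) x"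
    if "m < n" for m x
    using that
  proof (induction m)
    case (Suc m)
    { case 1
      then show ?case
        using Suc.IH(1) step(1)[of "int m" x] by (simp add: scaleC_scaleC add.commute)
    next
      case 2
      have "- int (Suc m) = - int m - 1" by simp
      with 2 show ?case
        using Suc.IH(2) step(2)[of "- int m" x] by (simp only:) (simp add: scaleC_scaleC) }
  qed (simp_all add: scaleC_one)
  have l_cases: "\<exists>m<n. l = int m \<or> l = - int m" if "\<bar>l\<bar> < int n" for l
    using that by (intro exI[of _ "nat \<bar>l\<bar>"]) auto
  \<comment> \<open>Unimodularity comes from a step from 0 to 1 and back, which requires
    \<open>n > 1\<close> and \<open>\<tau> 0 \<noteq> 0\<close>. In the other cases
    \<open>\<mu> = 1\<close> works.\<close>
  show ?thesis
  proof (cases "n = 1 \<or> \<tau> 0 = 0")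
    case True
    then show ?thesis
    proof
      assume "n = 1"
      then show ?thesis
        by (intro exI[of _ 1]) (auto intro!: blinfun_eqI simp: scaleC_operator.rep_eq scaleC_one)
    next
      assume 0: "\<tau> 0 = 0"
      have "\<tau> l = 0" if "\<bar>l\<bar> < int n" for l
        using l_cases[OF that] by (auto intro!: blinfun_eqI simp: pos_power neg_power 0)
      then show ?thesis
        by (intro exI[of _ 1]) (auto intro!: blinfun_eqI simp: scaleC_operator.rep_eq scaleC_one 0)
    qed
  next
    case False
    then obtain x where x: "blinfun_apply (\<tau> 0) x \<noteq> 0"
      by (metis blinfun_eqI zero_blinfun.rep_eq)
    have "blinfun_apply (\<tau> 0) x = (cnj \<mu> * \<mu>) *\<^sub>C blinfun_apply (\<tau> 0) x"
      using step(2)[of 1 x] step(1)[of 0 x] False n by (simp add: scaleC_scaleC)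
    then have "(1 - cnj \<mu> * \<mu>) *\<^sub>C blinfun_apply (\<tau> 0) x = 0"
      by (simp add: complex_vector.scale_left_diff_distrib scaleC_one)
    then have \<mu>1: "\<mu> * cnj \<mu> = 1"
      using x by (simp add: mult.commute)
    then have norm: "cmod \<mu> = 1"
      by (metis complex_mod_sqrt_Re_mult_cnj one_complex.sel(1) real_sqrt_one)
    have inv: "inverse \<mu> = cnj \<mu>"
      using \<mu>1 by (rule inverse_unique)
    have "\<tau> l = scaleC_operator (\<mu> powi l) (\<tau> 0)" if "\<bar>l\<bar> < int n" for l
      using l_cases[OF that]
      by (auto intro!: blinfun_eqI simp: pos_power neg_power scaleC_operator.rep_eq
          power_int_minus inv simp flip: power_inverse)
    with norm show ?thesis by blast
  qed
qed

section \<open>Rank-one projections\<close>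

lemma rank_one_operator:
  fixes g :: "'h::chilbert_space"
  shows "\<exists>B\<in>bounded_operators. \<forall>x. blinfun_apply B x = (c * cinner x g) *\<^sub>C g"
proof -
  have bound: "norm ((c * cinner x g) *\<^sub>C g) \<le> norm x * (2 * cmod c * norm g * norm g)" for x
  proof -
    have "norm ((c * cinner x g) *\<^sub>C g) = cmod c * norm g * cmod (cinner x g)"
      by (simp add: norm_scaleC norm_mult)
    also have "\<dots> \<le> cmod c * norm g * (2 * norm x * norm g)"
      by (intro mult_left_mono norm_cinner_le) simp
    finally show ?thesis by (simp add: algebra_simps)
  qed
  have "\<exists>B\<in>bounded_operators. blinfun_apply B = (\<lambda>x. (c * cinner x g) *\<^sub>C g)"
  proof (rule bounded_operatorsI[OF _ _ bound])
    show "(c * cinner (x + y) g) *\<^sub>C g = (c * cinner x g) *\<^sub>C g + (c * cinner y g) *\<^sub>C g" for x y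
      by (simp add: cinner_add_left distrib_left scaleC_add_left)
    show "(c * cinner (a *\<^sub>C x) g) *\<^sub>C g = a *\<^sub>C (c * cinner x g) *\<^sub>C g" for a x
      by (simp add: cinner_scaleC_left scaleC_scaleC mult.left_commute)
  qed
  then show ?thesis by (metis (no_types, lifting))
qed

lemma rank_one_projection_exists:
  fixes q :: "'h::chilbert_space"
  assumes q: "norm q = 1"
  shows "\<exists>Q. projection Q \<and> rank_one Q \<and> (\<forall>x. blinfun_apply Q x = cinner x q *\<^sub>C q)"
proof -
  obtain Q where Q: "Q \<in> bounded_operators" and app: "\<And>x. blinfun_apply Q x = cinner x q *\<^sub>C q"
    using rank_one_operator[of 1 q] by auto
  have qq: "cinner q q = 1" and "q \<noteq> 0"
    using q by (auto simp: cinner_norm)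
  have "Q o\<^sub>L Q = Q"
    by (rule blinfun_eqI) (simp add: app cinner_simps qq)
  moreover have "cinner (blinfun_apply Q x) y = cinner x (blinfun_apply Q y)" for x y
    by (simp add: app cinner_simps cinner_commute[of q y])
  ultimately have "projection Q"
    using Q by (simp add: projection_def)
  moreover have "range (blinfun_apply Q) = complex_vector.span {q}"
  proof -
    have "c *\<^sub>C q \<in> range (blinfun_apply Q)" for c
      by (rule range_eqI[of _ _ "c *\<^sub>C q"]) (simp add: app cinner_simps qq)
    then show ?thesis
      by (auto simp: complex_vector.span_singleton app)
  qed
  moreover have "complex_vector.independent {q}"
    using \<open>q \<noteq> 0\<close> by simp
  ultimately have "rank_one Q"
    by (simp add: rank_one_def complex_vector.dim_span_eq_card_independent del: complex_vector.dim_span)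
  with \<open>projection Q\<close> app show ?thesis by blast
qed

text \<open>Idempotence fixes a spanning vector of the range; self-adjointness then identifies the
  coefficient, as \<open>cinner x q = cinner (blinfun_apply Q x) q\<close>.\<close>

lemma rank_one_projection_form:
  fixes Q :: "'h::chilbert_space \<Rightarrow>\<^sub>L 'h"
  assumes Q: "projection Q" and rank: "rank_one Q"
  shows "\<exists>q. norm q = 1 \<and> (\<forall>x. blinfun_apply Q x = cinner x q *\<^sub>C q)"
proof -
  obtain B where B: "B \<subseteq> range (blinfun_apply Q)" "complex_vector.independent B"
    "range (blinfun_apply Q) \<subseteq> complex_vector.span B" "card B = 1"
    using complex_vector.basis_exists[of "range (blinfun_apply Q)"] rank
    by (auto simp: rank_one_def)
  then obtain g where g: "B = {g}"
    by (auto simp: card_1_singleton_iff)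
  have "g \<noteq> 0"
    using B(2) g by auto
  have idem: "blinfun_apply Q (blinfun_apply Q x) = blinfun_apply Q x" for x
    using Q unfolding projection_def by (metis blinfun_apply_blinfun_compose)
  have Qg: "blinfun_apply Q g = g"
    using B(1) g idem by auto
  define q where "q = (1 / norm g) *\<^sub>R g"
  have nq: "norm q = 1" and qq: "cinner q q = 1"
    using \<open>g \<noteq> 0\<close> by (simp_all add: q_def cinner_norm)
  have Qq: "blinfun_apply Q q = q"
    by (simp add: q_def blinfun.scaleR_right Qg)
  have g_q: "g = norm g *\<^sub>R q"
    using \<open>g \<noteq> 0\<close> by (simp add: q_def)
  have "blinfun_apply Q x = cinner x q *\<^sub>C q" for x
  proof -
    obtain c where "blinfun_apply Q x = c *\<^sub>C g"
      using B(3) g by (force simp: complex_vector.span_singleton)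
    then have c: "blinfun_apply Q x = (c * norm g) *\<^sub>C q"
      by (subst (asm) g_q) (simp add: scaleR_scaleC scaleC_scaleC)
    have "cinner x q = cinner (blinfun_apply Q x) q"
      using Q Qq by (simp add: projection_def)
    also have "\<dots> = c * norm g"
      by (simp add: c cinner_simps qq)
    finally show ?thesis
      by (simp add: c)
  qed
  with nq show ?thesis by blast
qed

section \<open>Toeplitz matrices of rank one symbol\<close>

text \<open>This is the operator \<open>V\<close> from the direct sum to the Hilbert space with
  \<open>T_mat n \<mu> \<otimes>\<^sub>o A = V^* A V\<close> for unimodular
  \<open>\<mu>\<close>.\<close>

definition twisted_sum :: "nat \<Rightarrow> complex \<Rightarrow> (nat \<Rightarrow> 'h::chilbert_space) \<Rightarrow> 'h" where
  "twisted_sum n \<mu> x = (\<Sum>j<n. cnj \<mu> ^ j *\<^sub>C x j)"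

lemma twisted_sum_single:
  "i < n \<Longrightarrow> twisted_sum n \<mu> (single i x) = cnj \<mu> ^ i *\<^sub>C (x::'h::chilbert_space)"
proof -
  assume "i < n"
  have "twisted_sum n \<mu> (single i x) = (\<Sum>j<n. if j = i then cnj \<mu> ^ j *\<^sub>C x else 0)"
    unfolding twisted_sum_def by (intro sum.cong) (auto simp: single_def)
  with \<open>i < n\<close> show ?thesis by simp
qed

lemma twisted_sum_add: "twisted_sum n \<mu> (x + y) = twisted_sum n \<mu> x + twisted_sum n \<mu> y"
  by (simp add: twisted_sum_def scaleC_add_right sum.distrib)

lemma twisted_sum_scaleC: "twisted_sum n \<mu> (\<lambda>j. c *\<^sub>C x j) = c *\<^sub>C twisted_sum n \<mu> x"
  by (simp add: twisted_sum_def complex_vector.scale_sum_right scaleC_scaleC mult.commute)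

lemma unit_powi_diff:
  assumes "cmod \<mu> = 1"
  shows "\<mu> powi (int k - int j) = \<mu> ^ k * cnj \<mu> ^ j"
proof -
  have "\<mu> \<noteq> 0" "\<mu> * cnj \<mu> = 1"
    using assms by (auto simp flip: complex_norm_square)
  then show ?thesis
    by (simp add: power_int_diff divide_inverse inverse_unique flip: power_inverse)
qed

text \<open>For unimodular \<open>\<mu>\<close> the power splits into a row factor and a column
  factor, which the two twisted sums absorb. Positivity of \<open>A\<close> thus passes to the block
  matrix.\<close>

lemma geometric_toeplitz_form:
  assumes \<mu>: "cmod \<mu> = 1" and A: "A \<in> bounded_operators"
  shows "toeplitz_form n (\<lambda>l. scaleC_operator (\<mu> powi l) A) x y =
    cinner (blinfun_apply A (twisted_sum n \<mu> x)) (twisted_sum n \<mu> y)"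
proof -
  have cinner_sum_right: "cinner u (sum f S) = (\<Sum>s\<in>S. cinner u (f s))" for u :: 'a and f and S :: "nat set"
    by (induction S rule: infinite_finite_induct) (simp_all add: cinner_add_right)
  have "toeplitz_form n (\<lambda>l. scaleC_operator (\<mu> powi l) A) x y =
      (\<Sum>k<n. \<Sum>j<n. \<mu> ^ k * (cnj \<mu> ^ j * cinner (blinfun_apply A (x j)) (y k)))"
    by (simp add: toeplitz_form_def scaleC_operator.rep_eq cinner_simps unit_powi_diff[OF \<mu>] mult.assoc)
  also have "\<dots> = cinner (blinfun_apply A (twisted_sum n \<mu> x)) (twisted_sum n \<mu> y)"
    by (simp add: twisted_sum_def blinfun.sum_right bounded_operatorsD[OF A] cinner_sum_left
        cinner_sum_right cinner_simps sum_distrib_left)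
  finally show ?thesis .
qed

text \<open>With \<open>L x = cinner (twisted_sum n \<mu> x) q\<close>, the form of \<open>\<sigma>\<close> vanishes on the
  kernel of \<open>L\<close>, and by the Cauchy-Schwarz inequality it is a multiple of
  \<open>x, y \<mapsto> L x * cnj (L y)\<close>.\<close>

lemma dominated_geometric:
  fixes q :: "'h::chilbert_space"
  assumes n: "n \<ge> 1" and \<mu>: "cmod \<mu> = 1" and q: "norm q = 1"
    and Q: "\<And>x. blinfun_apply Q x = cinner x q *\<^sub>C q"
    and ops: "\<And>l. \<sigma> l \<in> bounded_operators"
    and pos: "\<And>x. toeplitz_form n \<sigma> x x \<in> \<real>\<^sub>\<ge>\<^sub>0"
    and dom: "\<And>x. cinner (twisted_sum n \<mu> x) q = 0 \<Longrightarrow> toeplitz_form n \<sigma> x x = 0"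
  defines "t \<equiv> Re (toeplitz_form n \<sigma> (single 0 q) (single 0 q))"
  shows "\<forall>l. \<bar>l\<bar> < int n \<longrightarrow> \<sigma> l = t *\<^sub>R scaleC_operator (\<mu> powi l) Q"
proof -
  let ?f = "toeplitz_form n \<sigma>" and ?e = "single 0 q"
  define L where "L x = cinner (twisted_sum n \<mu> x) q" for x
  have real: "?f x x \<in> \<real>" for x
    using pos nonneg_Reals_subset_Reals by blast
  note herm = real_form_hermitian[OF ops real]
  interpret symmetric_form "\<lambda>x y. Re (?f x y)"
  proof
    show "Re (?f x y) = Re (?f y x)" for x y
      using herm[of x y] by simp
  qed (rule toeplitz_form_bilinear)
  have psd: "psd_on UNIV"
    using pos by (simp add: psd_on_def complex_nonneg_Reals_iff)
  have ker: "?f x y = 0" if "L x = 0" for x y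
  proof -
    have "Re (?f x z) = 0" for z
      using cauchy_schwarz[OF psd, of x z] dom that by (simp add: seminorm_def L_def)
    from this[of y] this[of "\<lambda>j. \<i> *\<^sub>C y j"] show ?thesis
      by (simp add: toeplitz_form_scaleC_right complex_eq_iff)
  qed
  have L_e: "L ?e = 1"
    using n q by (simp add: L_def twisted_sum_single scaleC_one cinner_norm)
  have left: "?f x y = L x * ?f ?e y" for x y
  proof -
    \<comment> \<open>As \<open>L ?e = 1\<close>, subtracting \<open>L x\<close> times
      \<open>?e\<close> moves \<open>x\<close> into the kernel of \<open>L\<close>.\<close>
    let ?r = "\<lambda>j. (- L x) *\<^sub>C ?e j"
    have "L (x + ?r) = 0"
      using L_e by (simp add: L_def twisted_sum_add twisted_sum_scaleC cinner_simps
          del: complex_vector.scale_minus_left)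
    from ker[OF this, of y] show ?thesis
      by (simp add: toeplitz_form_add_left toeplitz_form_scaleC_left[OF ops]
          del: complex_vector.scale_minus_left)
  qed
  have t: "?f ?e ?e = of_real t"
    using real[of ?e] by (simp add: t_def)
  have form: "?f x y = L x * cnj (L y) * t" for x y
    using left[of x y] left[of y ?e] herm[of ?e y] t by simp
  show ?thesis
  proof (intro allI impI)
    fix l :: int assume l: "\<bar>l\<bar> < int n"
    obtain i k where ik: "i < n" "k < n" "l = int i - int k"
      using index_differenceE[OF l] .
    show "\<sigma> l = t *\<^sub>R scaleC_operator (\<mu> powi l) Q"
    proof (rule blinfun_eqI, rule cinner_eqI)
      fix x y
      have "cinner (blinfun_apply (\<sigma> l) x) y = ?f (single k x) (single i y)"
        using ik by (simp add: toeplitz_form_single)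
      also have "\<dots> = t * (\<mu> powi l * (cinner x q * cinner q y))"
        using ik by (simp add: form L_def twisted_sum_single cinner_simps unit_powi_diff[OF \<mu>]
            cinner_commute[of q y])
      also have "\<dots> = cinner (blinfun_apply (t *\<^sub>R scaleC_operator (\<mu> powi l) Q) x) y"
        by (simp add: blinfun.scaleR_left scaleC_operator.rep_eq Q cinner_simps)
      finally show "cinner (blinfun_apply (\<sigma> l) x) y =
          cinner (blinfun_apply (t *\<^sub>R scaleC_operator (\<mu> powi l) Q) x) y" .
    qed
  qed
qed

text \<open>Both summands satisfy \<open>dominated_geometric\<close>, so each is a multiple of the
  same matrix; evaluation at \<open>single 0 q\<close> shows that the multiples add up to
  \<open>\<alpha>\<close>.\<close>

lemma geometric_pure:
  fixes Q :: "'h::chilbert_space \<Rightarrow>\<^sub>L 'h"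
  assumes n: "n \<ge> 1" and \<mu>: "cmod \<mu> = 1" and Q: "projection Q" "rank_one Q"
    and T: "T_mat n \<mu> \<otimes>\<^sub>o (\<alpha> *\<^sub>R Q) \<in> toeplitz_cone n"
  shows "pure_element (toeplitz_cone n) (T_mat n \<mu> \<otimes>\<^sub>o (\<alpha> *\<^sub>R Q))"
  unfolding pure_element_def
proof (intro conjI ballI impI T)
  fix \<theta> \<omega> :: "('h \<Rightarrow>\<^sub>L 'h) mat"
  assume "\<theta> \<in> toeplitz_cone n" "\<omega> \<in> toeplitz_cone n" and sum: "\<theta> + \<omega> = T_mat n \<mu> \<otimes>\<^sub>o (\<alpha> *\<^sub>R Q)"
  then obtain \<sigma> \<rho> where \<sigma>: "\<theta> = toeplitz_mat n \<sigma>" "\<And>l. \<sigma> l \<in> bounded_operators"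
      "\<And>x. toeplitz_form n \<sigma> x x \<in> \<real>\<^sub>\<ge>\<^sub>0"
    and \<rho>: "\<omega> = toeplitz_mat n \<rho>" "\<And>l. \<rho> l \<in> bounded_operators"
      "\<And>x. toeplitz_form n \<rho> x x \<in> \<real>\<^sub>\<ge>\<^sub>0"
    by (metis toeplitz_coneE)
  obtain q where q: "norm q = 1" and Qq: "\<And>x. blinfun_apply Q x = cinner x q *\<^sub>C q"
    using rank_one_projection_form[OF Q] by blast
  have \<alpha>Q: "\<alpha> *\<^sub>R Q \<in> bounded_operators"
    using Q by (intro bounded_operators_scaleR) (simp add: projection_def)
  have add: "\<sigma> l + \<rho> l = scaleC_operator (\<mu> powi l) (\<alpha> *\<^sub>R Q)" if "\<bar>l\<bar> < int n" for l
    using sum that by (simp add: \<sigma>(1) \<rho>(1) T_mat_tensor toeplitz_mat_add toeplitz_mat_eq_iff)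
  have form_add: "toeplitz_form n \<sigma> x x + toeplitz_form n \<rho> x x =
      \<alpha> * (cinner (twisted_sum n \<mu> x) q * cnj (cinner (twisted_sum n \<mu> x) q))" for x
  proof -
    have "toeplitz_form n \<sigma> x x + toeplitz_form n \<rho> x x = toeplitz_form n (\<lambda>l. \<sigma> l + \<rho> l) x x"
      by (simp add: toeplitz_form_def blinfun.add_left cinner_simps sum.distrib)
    also have "\<dots> = toeplitz_form n (\<lambda>l. scaleC_operator (\<mu> powi l) (\<alpha> *\<^sub>R Q)) x x"
      by (intro toeplitz_form_cong add refl)
    also have "\<dots> = \<alpha> * (cinner (twisted_sum n \<mu> x) q * cnj (cinner (twisted_sum n \<mu> x) q))"
      by (simp add: geometric_toeplitz_form[OF \<mu> \<alpha>Q] blinfun.scaleR_left Qq cinner_simps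
          cinner_commute[of q "twisted_sum n \<mu> x"])
    finally show ?thesis .
  qed
  \<comment> \<open>Two nonnegative numbers with sum zero both vanish.\<close>
  have dom: "toeplitz_form n \<sigma> x x = 0" "toeplitz_form n \<rho> x x = 0"
    if "cinner (twisted_sum n \<mu> x) q = 0" for x
    using form_add[of x] \<sigma>(3)[of x] \<rho>(3)[of x] that
    by (auto simp: complex_nonneg_Reals_iff complex_eq_iff)
  define t where "t = Re (toeplitz_form n \<sigma> (single 0 q) (single 0 q))"
  define t' where "t' = Re (toeplitz_form n \<rho> (single 0 q) (single 0 q))"
  have \<sigma>_eq: "\<sigma> l = t *\<^sub>R scaleC_operator (\<mu> powi l) Q" if "\<bar>l\<bar> < int n" for l
    using dominated_geometric[OF n \<mu> q Qq \<sigma>(2,3) dom(1)] that by (simp add: t_def)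
  have \<rho>_eq: "\<rho> l = t' *\<^sub>R scaleC_operator (\<mu> powi l) Q" if "\<bar>l\<bar> < int n" for l
    using dominated_geometric[OF n \<mu> q Qq \<rho>(2,3) dom(2)] that by (simp add: t'_def)
  have "t \<ge> 0" "t' \<ge> 0"
    using \<sigma>(3) \<rho>(3) by (simp_all add: t_def t'_def complex_nonneg_Reals_iff)
  have "cinner (twisted_sum n \<mu> (single 0 q)) q = 1"
    using n q by (simp add: twisted_sum_single scaleC_one cinner_norm)
  then have "t + t' = \<alpha>"
    using form_add[of "single 0 q"]
    by (simp add: t_def t'_def complex_eq_iff)
  \<comment> \<open>For \<open>\<alpha> = 0\<close> both \<open>t\<close> and \<open>t'\<close> are
    zero, and 0 is an arbitrary choice.\<close>
  define s where "s = (if \<alpha> = 0 then 0 else t / \<alpha>)"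
  have s: "t = s * \<alpha>" "t' = (1 - s) * \<alpha>" "0 \<le> s" "s \<le> 1"
    using \<open>t \<ge> 0\<close> \<open>t' \<ge> 0\<close> \<open>t + t' = \<alpha>\<close> by (auto simp: s_def field_simps)
  have scale: "(r * \<alpha>) *\<^sub>R scaleC_operator c Q = r *\<^sub>R scaleC_operator c (\<alpha> *\<^sub>R Q)" for r c
    by (rule blinfun_eqI) (simp add: blinfun.scaleR_left scaleC_operator.rep_eq scaleR_scaleC
        scaleC_scaleC mult_ac)
  show "\<exists>s\<in>{0..1}. \<theta> = map_mat (scaleR s) (T_mat n \<mu> \<otimes>\<^sub>o (\<alpha> *\<^sub>R Q)) \<and>
      \<omega> = map_mat (scaleR (1 - s)) (T_mat n \<mu> \<otimes>\<^sub>o (\<alpha> *\<^sub>R Q))"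
    using s(3,4) by (intro bexI[of _ s])
      (simp_all add: T_mat_tensor map_toeplitz_mat \<sigma>(1) \<rho>(1) toeplitz_mat_eq_iff \<sigma>_eq \<rho>_eq s(1,2) scale)
qed

section \<open>The coefficient operator of a pure element\<close>

lemma pure_coefficient:
  fixes A :: "'h::chilbert_space \<Rightarrow>\<^sub>L 'h"
  assumes n: "n \<ge> 1" and \<mu>: "cmod \<mu> = 1" and A: "A \<in> bounded_operators"
    and pure: "pure_element (toeplitz_cone n) (toeplitz_mat n (\<lambda>l. scaleC_operator (\<mu> powi l) A))"
    and ne: "A \<noteq> 0"
  shows "\<exists>Q \<alpha>. projection Q \<and> rank_one Q \<and> \<alpha> \<ge> 0 \<and> A = \<alpha> *\<^sub>R Q"
proof -
  let ?\<tau> = "\<lambda>B l. scaleC_operator (\<mu> powi l) B"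
  have \<tau>: "\<And>l. ?\<tau> A l \<in> bounded_operators"
    by (intro bounded_operators_scaleC A)
  have pos\<tau>: "positive_block n (toeplitz_mat n (?\<tau> A))"
    using pure by (simp add: pure_element_def toeplitz_cone_def)
  have herm: "cinner (blinfun_apply A x) y = cinner x (blinfun_apply A y)" for x y
    using positive_hermitian[OF \<tau> pos\<tau>, of 0 x y] n by (simp add: scaleC_operator.rep_eq scaleC_one)
  have nonneg: "cinner (blinfun_apply A x) x \<in> \<real>\<^sub>\<ge>\<^sub>0" for x
  proof -
    have "toeplitz_form n (?\<tau> A) (single 0 x) (single 0 x) \<in> \<real>\<^sub>\<ge>\<^sub>0"
      using pos\<tau> by (simp add: positive_block_iff)
    then show ?thesis
      using n by (simp add: geometric_toeplitz_form[OF \<mu> A] twisted_sum_single scaleC_one)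
  qed
  interpret symmetric_form "\<lambda>x y. Re (cinner (blinfun_apply A x) y)"
  proof
    show "bilinear (\<lambda>x y. Re (cinner (blinfun_apply A x) y))"
      unfolding bilinear_def
      by (auto intro!: linearI simp: cinner_simps blinfun.add_right blinfun.scaleR_right)
    show "Re (cinner (blinfun_apply A x) y) = Re (cinner (blinfun_apply A y) x)" for x y
      by (simp add: herm cinner_form.sym[of x])
  qed
  have psd: "psd_on UNIV"
    using nonneg by (simp add: psd_on_def complex_nonneg_Reals_iff)
  obtain y where y: "blinfun_apply A y \<noteq> 0"
    using ne by (metis blinfun_eqI zero_blinfun.rep_eq)
  define g where "g = blinfun_apply A y"
  define c where "c = Re (cinner g y)"
  have c: "cinner g y = of_real c" "c \<ge> 0"
    using nonneg[of y] by (auto simp: c_def g_def complex_nonneg_Reals_iff complex_eq_iff)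
  \<comment> \<open>If \<open>c\<close> were zero, Cauchy-Schwarz for the form of \<open>A\<close>
    would give \<open>cinner (blinfun_apply A g) y = 0\<close> in real part, but this is the square
    of the norm of \<open>g\<close>.\<close>
  have "c \<noteq> 0"
  proof
    assume "c = 0"
    then have "Re (cinner (blinfun_apply A g) y) = 0"
      using cauchy_schwarz[OF psd, of g y] c by (simp add: seminorm_def g_def)
    then have "(norm g)\<^sup>2 = 0"
      by (simp add: herm cinner_norm flip: g_def)
    then show False
      using y by (simp add: g_def)
  qed
  with c have "c > 0" by simp
  obtain B where B: "B \<in> bounded_operators"
    and Bx: "\<And>x. blinfun_apply B x = (of_real (1 / c) * cinner x g) *\<^sub>C g"
    using rank_one_operator[of "of_real (1 / c)" g] by blast
  have B_form: "cinner (blinfun_apply B x) x = of_real ((cmod (cinner x g))\<^sup>2 / c)" for x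
    using complex_norm_square[of "cinner x g"]
    by (simp add: Bx cinner_simps cinner_commute[of g x] mult.assoc)
  have B_pos: "cinner (blinfun_apply B x) x \<in> \<real>\<^sub>\<ge>\<^sub>0" for x
    using \<open>c > 0\<close> by (simp add: B_form)
  have AB: "A - B \<in> bounded_operators"
    using A B by (simp add: bounded_operators_def blinfun.diff_left complex_vector.scale_right_diff_distrib)
  have AB_pos: "cinner (blinfun_apply (A - B) x) x \<in> \<real>\<^sub>\<ge>\<^sub>0" for x
  proof -
    \<comment> \<open>This \<open>t\<close> minimises the form of \<open>A\<close> at
      \<open>x - t *\<^sub>C y\<close>; the minimum is the form of \<open>A - B\<close>, a Schur
      complement.\<close>
    define t where "t = cinner x g / c"
    have Ax: "cinner (blinfun_apply A x) y = t * c"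
      using \<open>c > 0\<close> by (simp add: herm t_def flip: g_def)
    have Ay: "cinner g x = cnj t * c"
      using \<open>c > 0\<close> cinner_commute[of g x] by (simp add: t_def)
    have "cinner (blinfun_apply A (x - t *\<^sub>C y)) (x - t *\<^sub>C y) =
        cinner (blinfun_apply A x) x - t * cnj t * c"
      by (simp add: blinfun.diff_right bounded_operatorsD[OF A] cinner_simps c Ax Ay
          algebra_simps flip: g_def)
    also have "t * cnj t * c = cinner (blinfun_apply B x) x"
      using \<open>c > 0\<close> by (simp add: Bx cinner_simps Ay t_def)
    finally show ?thesis
      using nonneg[of "x - t *\<^sub>C y"] by (simp add: blinfun.diff_left cinner_simps)
  qed
  have "\<exists>s. \<forall>l. \<bar>l\<bar> < int n \<longrightarrow> ?\<tau> B l = s *\<^sub>R ?\<tau> A l"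
  proof (rule pure_toeplitzD[OF pure])
    show "toeplitz_form n (?\<tau> B) x x \<in> \<real>\<^sub>\<ge>\<^sub>0" "toeplitz_form n (?\<tau> (A - B)) x x \<in> \<real>\<^sub>\<ge>\<^sub>0" for x
      by (simp_all only: geometric_toeplitz_form[OF \<mu> B] geometric_toeplitz_form[OF \<mu> AB] B_pos AB_pos)
    show "?\<tau> B l + ?\<tau> (A - B) l = ?\<tau> A l" for l
      by (rule blinfun_eqI)
        (simp add: blinfun.add_left blinfun.diff_left scaleC_operator.rep_eq flip: scaleC_add_right)
  qed (intro bounded_operators_scaleC B AB)+
  then obtain s where "\<And>l. \<bar>l\<bar> < int n \<Longrightarrow> ?\<tau> B l = s *\<^sub>R ?\<tau> A l"
    by blast
  from this[of 0] n have "scaleC_operator 1 B = s *\<^sub>R scaleC_operator 1 A"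
    by simp
  then have s: "blinfun_apply B x = s *\<^sub>R blinfun_apply A x" for x
    by (metis scaleC_operator.rep_eq blinfun.scaleR_left scaleC_one)
  \<comment> \<open>Both \<open>A\<close> and \<open>B\<close> send \<open>y\<close> to
    \<open>g\<close>, which is nonzero, so the factor \<open>s\<close> is 1.\<close>
  have "blinfun_apply B y = g"
    using c \<open>c > 0\<close> cinner_commute[of y g] by (simp add: Bx scaleC_one)
  then have "s *\<^sub>R g = g"
    using s[of y] by (simp add: g_def)
  then have "(s - 1) *\<^sub>R g = 0"
    by (simp add: scaleR_diff_left)
  then have "s = 1"
    using y by (simp add: g_def)
  define q where "q = (1 / norm g) *\<^sub>R g"
  have "g \<noteq> 0" using y by (simp add: g_def)
  then have "norm q = 1" by (simp add: q_def)
  then obtain Q where Q: "projection Q" "rank_one Q" "\<And>x. blinfun_apply Q x = cinner x q *\<^sub>C q"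
    using rank_one_projection_exists by blast
  have "A = ((norm g)\<^sup>2 / c) *\<^sub>R Q"
  proof (rule blinfun_eqI)
    fix x
    have "blinfun_apply A x = (of_real (1 / c) * cinner x g) *\<^sub>C g"
      using s[of x] \<open>s = 1\<close> by (simp add: Bx)
    then show "blinfun_apply A x = blinfun_apply (((norm g)\<^sup>2 / c) *\<^sub>R Q) x"
      using \<open>g \<noteq> 0\<close> by (simp add: blinfun.scaleR_left Q(3) q_def cinner_simps scaleR_scaleC
          scaleC_scaleC power2_eq_square)
  qed
  with Q \<open>c > 0\<close> show ?thesis
    by (intro exI[of _ Q] exI[of _ "(norm g)\<^sup>2 / c"]) simp
qed

section \<open>The characterisation of pure elements\<close>

theorem theorem3p2:
  fixes n :: nat and T :: "('h::chilbert_space \<Rightarrow>\<^sub>L 'h) mat"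
  assumes nonzero: "\<exists>x::'h. x \<noteq> 0"
    and n: "n \<ge> 1"
    and T: "T \<in> toeplitz_cone n"
  shows "pure_element (toeplitz_cone n) T \<longleftrightarrow>
    (\<exists>(lam::complex) (Q :: 'h \<Rightarrow>\<^sub>L 'h) (\<alpha>::real).
      cmod lam = 1 \<and> projection Q \<and> rank_one Q \<and> \<alpha> \<ge> 0 \<and>
      T = T_mat n (inverse lam) \<otimes>\<^sub>o (\<alpha> *\<^sub>R Q))"
proof
  assume "\<exists>(lam::complex) (Q :: 'h \<Rightarrow>\<^sub>L 'h) (\<alpha>::real).
      cmod lam = 1 \<and> projection Q \<and> rank_one Q \<and> \<alpha> \<ge> 0 \<and>
      T = T_mat n (inverse lam) \<otimes>\<^sub>o (\<alpha> *\<^sub>R Q)"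
  then obtain lam and Q :: "'h \<Rightarrow>\<^sub>L 'h" and \<alpha> where "cmod lam = 1" "projection Q" "rank_one Q"
    and TQ: "T = T_mat n (inverse lam) \<otimes>\<^sub>o (\<alpha> *\<^sub>R Q)"
    by blast
  then show "pure_element (toeplitz_cone n) T"
    using geometric_pure[OF n _ _ _ T[unfolded TQ]] by (simp add: norm_inverse)
next
  assume pure: "pure_element (toeplitz_cone n) T"
  obtain \<tau>\<^sub>0 where \<tau>\<^sub>0: "T = toeplitz_mat n \<tau>\<^sub>0" "\<And>l. \<tau>\<^sub>0 l \<in> bounded_operators"
    and pos: "positive_block n (toeplitz_mat n \<tau>\<^sub>0)"
    using T by (auto simp: toeplitz_cone_def toeplitz_tensor_def)
  obtain \<tau> where \<tau>: "\<And>l. \<tau> l \<in> bounded_operators" "\<And>l. \<bar>l\<bar> < int n \<Longrightarrow> \<tau> l = \<tau>\<^sub>0 l"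
    "positive_block (Suc n) (toeplitz_mat (Suc n) \<tau>)"
    using one_step_extension[OF n \<tau>\<^sub>0(2) pos] by blast
  have T\<tau>: "T = toeplitz_mat n \<tau>"
    using \<tau>(2) by (simp add: \<tau>\<^sub>0(1) toeplitz_mat_eq_iff)
  obtain \<mu> where \<mu>: "cmod \<mu> = 1" "\<And>l. \<bar>l\<bar> < int n \<Longrightarrow> \<tau> l = scaleC_operator (\<mu> powi l) (\<tau> 0)"
    using pure_geometric[OF n pure[unfolded T\<tau>] \<tau>(1)] \<tau>(3) by (auto simp: positive_block_iff)
  have T\<mu>: "T = toeplitz_mat n (\<lambda>l. scaleC_operator (\<mu> powi l) (\<tau> 0))"
    unfolding T\<tau> toeplitz_mat_eq_iff using \<mu>(2) by blast
  have "\<exists>(Q :: 'h \<Rightarrow>\<^sub>L 'h) \<alpha>. projection Q \<and> rank_one Q \<and> \<alpha> \<ge> 0 \<and> \<tau> 0 = \<alpha> *\<^sub>R Q"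
  proof (cases "\<tau> 0 = 0")
    \<comment> \<open>For the zero matrix \<open>\<alpha> = 0\<close> fits any rank-one projection,
      and one exists because the space is nonzero.\<close>
    case True
    obtain x :: 'h where "x \<noteq> 0" using nonzero by blast
    then have "norm ((1 / norm x) *\<^sub>R x) = 1" by simp
    from rank_one_projection_exists[OF this] True show ?thesis
      by (metis order_refl scaleR_zero_left)
  next
    case False
    from pure_coefficient[OF n \<mu>(1) \<tau>(1) pure[unfolded T\<mu>] False] show ?thesis .
  qed
  then obtain Q :: "'h \<Rightarrow>\<^sub>L 'h" and \<alpha> where Q: "projection Q" "rank_one Q" "\<alpha> \<ge> 0" "\<tau> 0 = \<alpha> *\<^sub>R Q"
    by blast
  \<comment> \<open>The ratio \<open>\<mu>\<close> is the inverse of the required unimodular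
    number.\<close>
  have "T = T_mat n (inverse (inverse \<mu>)) \<otimes>\<^sub>o (\<alpha> *\<^sub>R Q)"
    using T\<mu> Q(4) by (simp add: T_mat_tensor)
  with \<mu>(1) Q show "\<exists>(lam::complex) (Q :: 'h \<Rightarrow>\<^sub>L 'h) (\<alpha>::real).
      cmod lam = 1 \<and> projection Q \<and> rank_one Q \<and> \<alpha> \<ge> 0 \<and>
      T = T_mat n (inverse lam) \<otimes>\<^sub>o (\<alpha> *\<^sub>R Q)"
    by (intro exI[of _ "inverse \<mu>"] exI[of _ Q] exI[of _ \<alpha>]) (simp add: norm_inverse)
qed

end
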